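(* Let $\alpha$ be a nonzero algebraic integer which is not a root of unity. Then $$\overline{|\alpha|}\ge 1+\frac{c}{\deg(\alpha)}\quad\text{with } c=\theta_{259}^{-1}-1=0.016126\ldots.$$
   Context: $\overline{|\alpha|}$ (the house of $\alpha$) is the maximum modulus of the Galois conjugates of $\alpha$ (including $\alpha$). For $n\ge2$, $\theta_n$ denotes the unique root in $(0,1)$ of $-1+z+z^n$. *)

theory Defs
  imports "HOL-Analysis.Analysis" "HOL-Computational_Algebra.Computational_Algebra"
begin

text \<open>
  The minimal polynomial over the rationals. The description is only meaningful for
  algebraic \<open>\<alpha>\<close>, see \<open>min_poly_rat_ex1\<close> below.
\<close>

definition is_min_poly_rat :: "complex \<Rightarrow> rat poly \<Rightarrow> bool" where
  "is_min_poly_rat \<alpha> p \<longleftrightarrow>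
     lead_coeff p = 1 \<and> irreducible p \<and> poly (map_poly of_rat p) \<alpha> = 0"

definition min_poly_rat :: "complex \<Rightarrow> rat poly" where
  "min_poly_rat \<alpha> = (THE p. is_min_poly_rat \<alpha> p)"

definition alg_degree :: "complex \<Rightarrow> nat" where
  "alg_degree \<alpha> = degree (min_poly_rat \<alpha>)"

definition galois_conjugates :: "complex \<Rightarrow> complex set" where
  "galois_conjugates \<alpha> = {\<beta>. poly (map_poly of_rat (min_poly_rat \<alpha>)) \<beta> = 0}"

definition house :: "complex \<Rightarrow> real" where
  "house \<alpha> = Max (norm ` galois_conjugates \<alpha>)"

definition theta :: "nat \<Rightarrow> real" where
  "theta n = (THE z. 0 < z \<and> z < 1 \<and> - 1 + z + z ^ n = 0)"

lemma theta_ex1: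
  assumes "n \<ge> 2"
  shows "\<exists>!z::real. 0 < z \<and> z < 1 \<and> - 1 + z + z ^ n = 0"
proof -
  have "\<exists>z::real\<ge>0. z \<le> 1 \<and> - 1 + z + z ^ n = 0"
    using assms by (intro IVT') (auto simp: power_0_left intro!: continuous_intros)
  then obtain z :: real where z: "0 \<le> z" "z \<le> 1" "- 1 + z + z ^ n = 0"
    by blast
  have "z \<noteq> 0" "z \<noteq> 1"
    using z(3) assms by (auto simp: power_0_left)
  moreover have "x = y"
    if xy: "0 < x" "- 1 + x + x ^ n = 0" "0 < y" "- 1 + y + y ^ n = 0" for x y :: real
  proof (rule ccontr)
    assume "x \<noteq> y"
    then consider "x < y" | "y < x" by linarith
    then show False
      using xy power_mono[of x y n] power_mono[of y x n] by cases auto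
  qed
  ultimately show ?thesis
    using z by (metis order_le_less)
qed

lemma poly_of_rat_mult:
  "poly (map_poly of_rat (p * q)) x =
     poly (map_poly of_rat p) x * poly (map_poly of_rat q) (x :: complex)"
proof -
  have "map_poly of_rat (p * q) = map_poly of_rat p * (map_poly of_rat q :: complex poly)"
    by (rule poly_eqI) (simp add: coeff_map_poly coeff_mult of_rat_sum of_rat_mult)
  then show ?thesis by simp
qed

lemma poly_of_rat_add:
  "poly (map_poly of_rat (p + q)) x =
     poly (map_poly of_rat p) x + poly (map_poly of_rat q) (x :: complex)"
proof -
  have "map_poly of_rat (p + q) = map_poly of_rat p + (map_poly of_rat q :: complex poly)"
    by (rule poly_eqI) (simp add: coeff_map_poly of_rat_add)
  then show ?thesis by simp
qed

lemma min_poly_rat_ex1: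
  assumes "algebraic \<alpha>"
  shows "\<exists>!p. is_min_poly_rat \<alpha> p"
proof -
  define R where "R p \<longleftrightarrow> p \<noteq> 0 \<and> poly (map_poly of_rat p) \<alpha> = 0" for p :: "rat poly"
  obtain q :: "int poly" where q: "poly (map_poly of_int q) \<alpha> = 0" "q \<noteq> 0"
    using assms by (blast elim: algebraicE')
  have "map_poly of_rat (map_poly of_int q) = (map_poly of_int q :: complex poly)"
    by (rule poly_eqI) (simp add: coeff_map_poly)
  then have "R (map_poly of_int q)"
    using q by (auto simp: R_def map_poly_eq_0_iff)
  then obtain p where p: "R p" and min: "\<And>r. R r \<Longrightarrow> degree p \<le> degree r"
    using ex_has_least_nat[of R _ degree] by blast
  define m where "m = smult (inverse (lead_coeff p)) p"
  have pn: "p \<noteq> 0" using p by (simp add: R_def)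
  have m1: "lead_coeff m = 1" "degree m = degree p" "m \<noteq> 0"
    using pn by (auto simp: m_def)
  have m2: "poly (map_poly of_rat m) \<alpha> = 0"
    using p poly_of_rat_mult[of "[:inverse (lead_coeff p):]" p \<alpha>] by (simp add: m_def R_def)
  have irr: "irreducible m"
  proof (rule irreducibleI)
    show "m \<noteq> 0" by (fact m1)
    show "\<not> m dvd 1"
    proof
      assume "m dvd 1"
      then obtain c where c: "m = [:c:]"
        by (auto simp: is_unit_poly_iff)
      with m1 have "c = 1" by simp
      with m2 c show False by (simp add: map_poly_pCons)
    qed
    fix a b assume ab: "m = a * b"
    then have nz: "a \<noteq> 0" "b \<noteq> 0" using m1 by auto
    have "R a \<or> R b" using m2 nz by (auto simp: ab poly_of_rat_mult R_def)
    then have "degree b = 0 \<or> degree a = 0"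
      using min[of a] min[of b] m1(2) degree_mult_eq[OF nz] ab by auto
    then show "a dvd 1 \<or> b dvd 1"
      using nz by (auto simp: is_unit_iff_degree)
  qed
  with m1 m2 have ex: "is_min_poly_rat \<alpha> m"
    by (simp add: is_min_poly_rat_def)
  have "r = m" if r: "is_min_poly_rat \<alpha> r" for r
  proof -
    have "poly (map_poly of_rat r) \<alpha> =
        poly (map_poly of_rat (r div m * m + r mod m)) \<alpha>"
      by simp
    then have "poly (map_poly of_rat (r mod m)) \<alpha> = 0"
      using r m2 unfolding poly_of_rat_add poly_of_rat_mult is_min_poly_rat_def by simp
    then have "r mod m = 0"
      using min[of "r mod m"] degree_mod_less[OF \<open>m \<noteq> 0\<close>, of r] m1(2)
      by (cases "r mod m = 0") (auto simp: R_def)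
    then obtain k where k: "r = m * k"
      by (auto simp: mod_eq_0_iff_dvd elim: dvdE)
    have "k dvd 1"
      using r irreducibleD[of r m k] k irreducible_not_unit[OF irr]
      by (auto simp: is_min_poly_rat_def)
    then obtain a where a: "k = [:a:]"
      by (auto simp: is_unit_poly_iff)
    have "lead_coeff r = lead_coeff m * lead_coeff k"
      unfolding k by (rule lead_coeff_mult)
    then have "a = 1"
      using a r m1(1) by (simp add: is_min_poly_rat_def)
    then show ?thesis
      using k a by simp
  qed
  with ex show ?thesis by (rule_tac ex1I)
qed

end

theory Submission
  imports Defs "HOL-Complex_Analysis.Complex_Analysis" "Jordan_Normal_Form.Determinant"
begin

text \<open>
  This is Dimitrov's argument, with an elementary substitute for Dubinin's capacity theorem that
  only costs a constant factor. Let \<open>x\<^sub>1, \<dots>, x\<^sub>d\<close> be the conjugates of \<open>\<alpha>\<close>. The polynomials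
  \<open>\<Prod> (1 - x\<^sub>i\<^sup>2 X)\<close> and \<open>\<Prod> (1 - x\<^sub>i\<^sup>4 X)\<close> are congruent modulo 4, so the square root of their product is a
  power series with integer coefficients. It is the expansion at infinity (in \<open>1/z\<close>) of a function that is
  holomorphic outside the hedgehog of the \<open>2d\<close> segments from \<open>0\<close> to \<open>x\<^sub>i\<^sup>2\<close> and \<open>x\<^sub>i\<^sup>4\<close>. If all \<open>|x\<^sub>i|\<close> are less than
  \<open>exp (h / d)\<close> with \<open>h = 0.0165 > c\<close>, this hedgehog has capacity less than 1; hence the Hankel determinants of the series,
  which are integers, tend to 0, and the series is rational by Kronecker's criterion. Then all roots of the
  product have even multiplicity, which is impossible unless \<open>{x\<^sub>i}\<close> is symmetric under negation, and in that case
  one descends to the set of squares.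

  For the capacity, the logarithmic energy of points \<open>exp (T - t\<^sub>i + \<i> \<theta>\<^sub>i)\<close> is expanded into the
  kernels \<open>exp (- k |t\<^sub>i - t\<^sub>j|) cos (k (\<theta>\<^sub>i - \<theta>\<^sub>j)) / k\<close>, which are positive semidefinite. Replacing \<open>1/k\<close> by the
  smaller weight \<open>2 l exp (- l k)\<close> turns the sum into a Poisson kernel; it is positive, and large for two
  points on the same spine. As there are few spines, many pairs share one.
\<close>

section \<open>Logarithmic energy of points on a hedgehog\<close>

text \<open>Peel off the smallest value \<open>x k\<close>: \<open>min (x i) (x j)\<close> is
  \<open>x k\<close> plus the same kernel for the values \<open>x i - x k\<close>. The constant
  contributes \<open>x k\<close> times a square, and the shifted kernel vanishes in row and column
  \<open>k\<close>, so the induction continues on \<open>I - {k}\<close>.\<close>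

lemma min_kernel_nonneg:
  fixes x c :: "'a \<Rightarrow> real"
  assumes "finite I" "\<And>i. i \<in> I \<Longrightarrow> 0 \<le> x i"
  shows "0 \<le> (\<Sum>i\<in>I. \<Sum>j\<in>I. c i * c j * min (x i) (x j))"
  using assms
proof (induction "card I" arbitrary: I x)
  case 0
  then show ?case by simp
next
  case (Suc m)
  have "I \<noteq> {}" using Suc.hyps(2) by auto
  then obtain k where k: "k \<in> I" "\<And>i. i \<in> I \<Longrightarrow> x k \<le> x i"
    using arg_min_if_finite[of I x] Suc.prems(1) by (metis not_le)
  let ?y = "\<lambda>i. x i - x k"
  have "0 \<le> (\<Sum>i\<in>I - {k}. \<Sum>j\<in>I - {k}. c i * c j * min (?y i) (?y j))"
    using Suc.hyps(2) Suc.prems k by (intro Suc.hyps(1)) auto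
  also have "\<dots> = (\<Sum>i\<in>I. \<Sum>j\<in>I. c i * c j * min (?y i) (?y j))"
  proof -
    have "(\<Sum>i\<in>I - {k}. \<Sum>j\<in>I - {k}. c i * c j * min (?y i) (?y j))
        = (\<Sum>i\<in>I - {k}. \<Sum>j\<in>I. c i * c j * min (?y i) (?y j))"
      using k Suc.prems(1) by (intro sum.cong sum.mono_neutral_left refl) auto
    also have "\<dots> = (\<Sum>i\<in>I. \<Sum>j\<in>I. c i * c j * min (?y i) (?y j))"
      using k Suc.prems(1) by (intro sum.mono_neutral_left) (auto intro!: sum.neutral)
    finally show ?thesis .
  qed
  finally have "0 \<le> x k * (\<Sum>i\<in>I. c i)\<^sup>2 + (\<Sum>i\<in>I. \<Sum>j\<in>I. c i * c j * min (?y i) (?y j))"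
    using k Suc.prems(2) by simp
  also have "x k * (\<Sum>i\<in>I. c i)\<^sup>2 = (\<Sum>i\<in>I. \<Sum>j\<in>I. c i * c j * x k)"
    by (simp add: power2_eq_square sum_product sum_distrib_left mult_ac)
  also have "\<dots> + (\<Sum>i\<in>I. \<Sum>j\<in>I. c i * c j * min (?y i) (?y j))
      = (\<Sum>i\<in>I. \<Sum>j\<in>I. c i * c j * (x k + min (?y i) (?y j)))"
    by (simp add: sum.distrib distrib_left)
  also have "\<dots> = (\<Sum>i\<in>I. \<Sum>j\<in>I. c i * c j * min (x i) (x j))"
    by (intro sum.cong refl arg_cong2[of _ _ _ _ "(*)"]) auto
  finally show ?case .
qed

text \<open>Up to the factors \<open>exp (k * t i)\<close> and \<open>exp (k * t j)\<close>, the
  radial part is the minimum of \<open>exp (- 2 * k * t i)\<close> and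
  \<open>exp (- 2 * k * t j)\<close>. The addition theorem for the cosine then splits the form into
  two forms with the minimum kernel.\<close>

lemma radial_kernel_nonneg:
  fixes t \<theta> :: "'a \<Rightarrow> real"
  assumes "finite I" "0 \<le> k"
  shows "0 \<le> (\<Sum>i\<in>I. \<Sum>j\<in>I. exp (- k * \<bar>t i - t j\<bar>) * cos (k * (\<theta> i - \<theta> j)))"
proof -
  let ?c = "\<lambda>i. exp (k * t i) * cos (k * \<theta> i)" and ?s = "\<lambda>i. exp (k * t i) * sin (k * \<theta> i)"
  let ?x = "\<lambda>i. exp (- 2 * k * t i)"
  have e: "exp (- k * \<bar>t i - t j\<bar>) = exp (k * t i) * exp (k * t j) * min (?x i) (?x j)" for i j
  proof (cases "t i \<le> t j")
    case True
    then have "k * t i \<le> k * t j" using assms by (simp add: mult_left_mono)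
    then show ?thesis using True by (simp add: min_def flip: exp_add) (auto simp: algebra_simps)
  next
    case False
    then have "k * t j \<le> k * t i" using assms by (simp add: mult_left_mono)
    then show ?thesis using False by (simp add: min_def flip: exp_add) (auto simp: algebra_simps)
  qed
  have "exp (- k * \<bar>t i - t j\<bar>) * cos (k * (\<theta> i - \<theta> j)) =
    ?c i * ?c j * min (?x i) (?x j) + ?s i * ?s j * min (?x i) (?x j)" for i j
    unfolding e by (simp add: right_diff_distrib cos_diff algebra_simps)
  then have "(\<Sum>i\<in>I. \<Sum>j\<in>I. exp (- k * \<bar>t i - t j\<bar>) * cos (k * (\<theta> i - \<theta> j))) =
    (\<Sum>i\<in>I. \<Sum>j\<in>I. ?c i * ?c j * min (?x i) (?x j)) + (\<Sum>i\<in>I. \<Sum>j\<in>I. ?s i * ?s j * min (?x i) (?x j))"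
    by (simp add: sum.distrib)
  then show ?thesis
    using min_kernel_nonneg[OF assms(1), of ?x ?c] min_kernel_nonneg[OF assms(1), of ?x ?s] by simp
qed

text \<open>Contracting \<open>u\<close> by \<open>s\<close> keeps the logarithm finite on the
  diagonal, where \<open>u = 1\<close>, at a cost of \<open>1 - s\<close> per pair. The bound
  combines \<open>(1 + s) * norm (1 - u) \<le> 2 * norm (1 - s * u)\<close> with
  \<open>2 \<le> (1 + s) * exp (1 - s)\<close>.\<close>

lemma norm_one_minus_le_contracted:
  fixes u :: complex
  assumes "norm u \<le> 1" "0 < s" "s < 1"
  shows "norm (1 - u) \<le> exp (1 - s) * norm (1 - of_real s * u)"
proof -
  define q where "q = (norm u)\<^sup>2"
  have q: "q = (Re u)\<^sup>2 + (Im u)\<^sup>2" by (simp add: q_def cmod_power2)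
  have q1: "q \<le> 1" using assms by (simp add: q_def power_le_one)
  have n1: "(norm (1 - u))\<^sup>2 = 1 - 2 * Re u + q"
    unfolding cmod_power2 q by (simp add: power2_eq_square algebra_simps)
  have n2: "(norm (1 - of_real s * u))\<^sup>2 = 1 - 2 * s * Re u + s\<^sup>2 * q"
    unfolding cmod_power2 q by (simp add: power2_eq_square algebra_simps)
  \<comment> \<open>The right-hand side is the square of \<open>norm (1 + u)\<close>.\<close>
  have "0 \<le> 2 * Re u + (1 + q)"
    using sum_squares_ge_zero[of "1 + Re u" "Im u"] by (simp add: q power2_eq_square algebra_simps)
  then have "0 \<le> (1 - s) * ((1 - s) * (2 * Re u + (1 + q)) + (2 + 2 * s) * (1 - q))"
    using assms q1
    by (intro mult_nonneg_nonneg[of "1 - s"] add_nonneg_nonneg[of "(1 - s) * _"] mult_nonneg_nonneg) auto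
  also have "\<dots> = 4 * (1 - 2 * s * Re u + s\<^sup>2 * q) - (1 + s)\<^sup>2 * (1 - 2 * Re u + q)"
    by (simp add: power2_eq_square algebra_simps)
  finally have "((1 + s) * norm (1 - u))\<^sup>2 \<le> (2 * norm (1 - of_real s * u))\<^sup>2"
    unfolding power_mult_distrib n1 n2 by simp
  then have "(1 + s) * norm (1 - u) \<le> 2 * norm (1 - of_real s * u)"
    by (rule power2_le_imp_le) simp
  also have "2 \<le> (1 + s) * exp (1 - s)"
  proof -
    have "2 \<le> (1 + s) * (1 + (1 - s))"
      using assms mult_nonneg_nonneg[of s "1 - s"] by (simp add: algebra_simps)
    also have "\<dots> \<le> (1 + s) * exp (1 - s)"
      using assms by (intro mult_left_mono exp_ge_add_one_self) auto
    finally show ?thesis .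
  qed
  finally have "(1 + s) * norm (1 - u) \<le> (1 + s) * (exp (1 - s) * norm (1 - of_real s * u))"
    by (simp add: mult_right_mono mult_ac)
  then show ?thesis using assms by simp
qed

text \<open>The real part of \<open>(1 + v) / (1 - v)\<close> is the Poisson kernel, which is
  nonnegative in the disc, and \<open>v / (1 - v)\<close> is half of
  \<open>(1 + v) / (1 - v) - 1\<close>.\<close>

lemma Re_geometric_ge:
  fixes v :: complex
  assumes "norm v < 1"
  shows "- (1/2) \<le> Re (v / (1 - v))"
proof -
  have "v \<noteq> 1" using assms by auto
  then have "v / (1 - v) = (1 + v) / (1 - v) / 2 - 1 / 2" by (simp add: field_simps)
  moreover have "0 \<le> Re ((1 + v) / (1 - v))"
  proof -
    have "(Re v)\<^sup>2 + (Im v)\<^sup>2 \<le> 1"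
      using assms by (metis cmod_power2 less_imp_le norm_ge_zero power_le_one)
    moreover have "Re ((1 + v) / (1 - v)) = (1 - ((Re v)\<^sup>2 + (Im v)\<^sup>2)) / ((1 - Re v)\<^sup>2 + (Im v)\<^sup>2)"
      unfolding Re_divide by (intro arg_cong2[of _ _ _ _ "(/)"]) (simp_all add: power2_eq_square algebra_simps)
    ultimately show ?thesis by simp
  qed
  ultimately have "Re (v / (1 - v)) = Re ((1 + v) / (1 - v)) / 2 - 1 / 2" "0 \<le> Re ((1 + v) / (1 - v))"
    by (simp_all del: divide_divide_eq_left)
  then show ?thesis by simp
qed

text \<open>For two points on one spine the kernel has a real argument \<open>exp (- y)\<close> and
  is about \<open>1 / y\<close>. Clearing denominators leaves the function
  \<open>(y - 2) * exp y + (y + 2)\<close>, which vanishes at 0 and has the nonnegative derivative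
  \<open>(y - 1) * exp y + 1\<close>.\<close>

lemma geometric_exp_ge:
  fixes y :: real
  assumes "0 < y"
  shows "1 / y - 1 / 2 \<le> exp (- y) / (1 - exp (- y))"
proof -
  have "0 \<le> (y - 2) * exp y + (y + 2)"
  proof -
    let ?g = "\<lambda>y::real. (y - 2) * exp y + (y + 2)"
    have "?g 0 \<le> ?g y"
    proof (rule DERIV_nonneg_imp_nondecreasing[of 0 y ?g])
      show "0 \<le> y" using assms by simp
      fix x :: real assume "0 \<le> x"
      have "1 - x \<le> exp (- x)" using exp_ge_add_one_self[of "- x"] by simp
      then have "(1 - x) * exp x \<le> exp (- x) * exp x" by (intro mult_right_mono) auto
      then have "0 \<le> (x - 1) * exp x + 1" by (simp add: algebra_simps flip: exp_add)
      moreover have "(?g has_real_derivative ((x - 1) * exp x + 1)) (at x)"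
        by (auto intro!: derivative_eq_intros simp: algebra_simps)
      ultimately show "\<exists>y. (?g has_real_derivative y) (at x) \<and> 0 \<le> y" by blast
    qed
    then show ?thesis by simp
  qed
  moreover have "exp (- y) / (1 - exp (- y)) = 1 / (exp y - 1)"
    using assms by (simp add: exp_minus field_simps)
  moreover have "1 / y - 1 / 2 \<le> 1 / (exp y - 1) \<longleftrightarrow> (2 - y) * (exp y - 1) \<le> 2 * y"
    using assms by (simp add: divide_simps mult.commute)
  ultimately show ?thesis by (simp add: algebra_simps)
qed

lemma sums_ln_norm_one_minus:
  fixes v :: complex
  assumes "norm v < 1"
  shows "(\<lambda>k. Re (v ^ Suc k) / real (Suc k)) sums (- ln (norm (1 - v)))"
proof -
  have ne: "1 - v \<noteq> 0" using assms by auto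
  have "(\<lambda>n. (-1)^Suc n / of_nat n * (- v)^n) sums ln (1 - v)"
    using Ln_series[of "- v"] assms by simp
  moreover have "(\<lambda>n. (-1)^Suc n / of_nat n * (- v)^n) = (\<lambda>n. - (v ^ n / of_nat n))"
    by (simp add: fun_eq_iff power_mult_distrib[symmetric])
  ultimately have "(\<lambda>n. - (v ^ n / of_nat n)) sums ln (1 - v)" by (simp only:)
  then have "(\<lambda>n. - (v ^ Suc n / of_nat (Suc n))) sums ln (1 - v)"
    by (subst sums_Suc_iff) simp
  from sums_minus[OF sums_Re[OF this]] show ?thesis
    using ne by (simp add: Re_divide_of_nat del: of_nat_Suc power_Suc)
qed

lemma polar_power:
  "(of_real r * (of_real (exp (- a)) * cis b)) ^ m
    = of_real (r ^ m * exp (- real m * a)) * cis (real m * b)"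
  by (simp add: power_mult_distrib Complex.DeMoivre flip: exp_of_nat_mult of_real_power)

text \<open>The negated sides are series in the kernels \<open>K k\<close>, whose double sums are
  nonnegative, so only the weights have to be compared:
  \<open>1 / m \<ge> 2 * l * exp (- l * m)\<close>, which is \<open>2 * x \<le> exp x\<close> at
  \<open>x = m * l\<close>. The smaller weights produce a geometric series with ratio
  \<open>v i j\<close>.\<close>

lemma log_energy_le:
  fixes t \<theta> :: "'a \<Rightarrow> real"
  assumes I: "finite I" and s: "0 < s" "s < 1" and l: "0 < l"
  defines "u \<equiv> \<lambda>i j. of_real (exp (- \<bar>t i - t j\<bar>)) * cis (\<theta> i - \<theta> j)"
  defines "v \<equiv> \<lambda>i j. of_real (s * exp (- l)) * u i j"
  shows "(\<Sum>i\<in>I. \<Sum>j\<in>I. ln (norm (1 - of_real s * u i j)))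
    \<le> - (2 * l * (\<Sum>i\<in>I. \<Sum>j\<in>I. Re (v i j / (1 - v i j))))"
proof -
  have se: "s * exp (- l) < 1"
    using s l mult_strict_mono[of s 1 "exp (- l)" 1] by simp
  have nu: "norm (u i j) \<le> 1" for i j by (simp add: u_def norm_mult)
  have nsu: "norm (of_real s * u i j) < 1" for i j
    using le_less_trans[OF mult_left_mono[OF nu, of s i j]] s by (simp add: norm_mult)
  have nv: "norm (v i j) < 1" for i j
    using le_less_trans[OF mult_left_mono[OF nu, of "s * exp (- l)" i j]] s se
    by (simp add: v_def norm_mult)
  define K where "K = (\<lambda>k i j. exp (- real (Suc k) * \<bar>t i - t j\<bar>) * cos (real (Suc k) * (\<theta> i - \<theta> j)))"
  have K0: "0 \<le> (\<Sum>i\<in>I. \<Sum>j\<in>I. K k i j)" for k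
    unfolding K_def by (rule radial_kernel_nonneg[OF I]) simp
  have 1: "(\<lambda>k. \<Sum>i\<in>I. \<Sum>j\<in>I. s ^ Suc k * K k i j / real (Suc k)) sums
      (\<Sum>i\<in>I. \<Sum>j\<in>I. - ln (norm (1 - of_real s * u i j)))"
  proof (intro sums_sum)
    fix i j
    have "Re ((of_real s * u i j) ^ Suc k) = s ^ Suc k * K k i j" for k
      unfolding u_def polar_power K_def by (simp del: power_Suc of_nat_Suc)
    then show "(\<lambda>k. s ^ Suc k * K k i j / real (Suc k)) sums (- ln (norm (1 - of_real s * u i j)))"
      using sums_ln_norm_one_minus[OF nsu, of i j] by simp
  qed
  have 2: "(\<lambda>k. 2 * l * (\<Sum>i\<in>I. \<Sum>j\<in>I. (s * exp (- l)) ^ Suc k * K k i j)) sums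
      (2 * l * (\<Sum>i\<in>I. \<Sum>j\<in>I. Re (v i j / (1 - v i j))))"
  proof (intro sums_sum sums_mult)
    fix i j
    have "Re (v i j ^ Suc k) = (s * exp (- l)) ^ Suc k * K k i j" for k
      unfolding v_def u_def polar_power K_def by (simp del: power_Suc of_nat_Suc)
    moreover have "(\<lambda>k. v i j ^ Suc k) sums (v i j / (1 - v i j))"
      using sums_mult[OF geometric_sums[OF nv], of "v i j" i j] by simp
    ultimately show "(\<lambda>k. (s * exp (- l)) ^ Suc k * K k i j) sums (Re (v i j / (1 - v i j)))"
      using sums_Re by fastforce
  qed
  have "2 * l * (\<Sum>i\<in>I. \<Sum>j\<in>I. (s * exp (- l)) ^ Suc k * K k i j)
      \<le> (\<Sum>i\<in>I. \<Sum>j\<in>I. s ^ Suc k * K k i j / real (Suc k))" for k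
  proof -
    let ?S = "\<Sum>i\<in>I. \<Sum>j\<in>I. K k i j" and ?x = "real (Suc k) * l"
    have "2 * ?x \<le> exp ?x"
    proof -
      have "2 * x \<le> 1 + x + x\<^sup>2 / 2" for x :: real
        using zero_le_power2[of "x - 1"] by (simp add: power2_eq_square algebra_simps)
      also have "1 + ?x + ?x\<^sup>2 / 2 \<le> exp ?x"
        using l by (intro exp_lower_Taylor_quadratic) simp
      finally show ?thesis .
    qed
    then have "2 * l * exp (- l) ^ Suc k \<le> 1 / real (Suc k)"
      unfolding exp_of_nat_mult[symmetric] by (simp add: exp_minus divide_simps mult_ac del: of_nat_Suc)
    then have "s ^ Suc k * (2 * l * exp (- l) ^ Suc k) * ?S \<le> s ^ Suc k * (1 / real (Suc k)) * ?S"
      using s K0 by (intro mult_right_mono mult_left_mono) auto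
    moreover have "(\<Sum>i\<in>I. \<Sum>j\<in>I. (s * exp (- l)) ^ Suc k * K k i j) = (s * exp (- l)) ^ Suc k * ?S"
      by (simp only: sum_distrib_left)
    moreover have "(\<Sum>i\<in>I. \<Sum>j\<in>I. s ^ Suc k * K k i j / real (Suc k))
        = s ^ Suc k * (1 / real (Suc k)) * ?S"
      by (simp add: sum_distrib_left del: power_Suc of_nat_Suc)
    ultimately show ?thesis
      by (simp only: power_mult_distrib mult_ac)
  qed
  then have "2 * l * (\<Sum>i\<in>I. \<Sum>j\<in>I. Re (v i j / (1 - v i j)))
      \<le> (\<Sum>i\<in>I. \<Sum>j\<in>I. - ln (norm (1 - of_real s * u i j)))"
    by (rule sums_le[OF _ 2 1])
  then show ?thesis by (simp add: sum_negf)
qed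


text \<open>The point of larger modulus, at depth \<open>min a b\<close>, is factored out; the
  quotient lies in the closed unit disc and can be contracted by \<open>s\<close>.\<close>

lemma norm_polar_diff_le:
  fixes T a b \<theta> \<theta>' s :: real
  assumes "0 < s" "s < 1"
  shows "norm (of_real (exp (T - a)) * cis \<theta> - of_real (exp (T - b)) * cis \<theta>')
    \<le> exp (T - min a b + (1 - s)) * norm (1 - of_real s * (of_real (exp (- \<bar>a - b\<bar>)) * cis (\<theta> - \<theta>')))"
proof -
  have main: "norm (of_real (exp (T - a)) * cis \<theta> - of_real (exp (T - b)) * cis \<theta>')
      \<le> exp (T - a + (1 - s)) * norm (1 - of_real s * (of_real (exp (a - b)) * cis (\<theta>' - \<theta>)))"
    if "a \<le> b" for a b \<theta> \<theta>'
  proof -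
    let ?u = "of_real (exp (a - b)) * cis (\<theta>' - \<theta>)"
    have "of_real (exp (T - a)) * cis \<theta> - of_real (exp (T - b)) * cis \<theta>'
        = of_real (exp (T - a)) * cis \<theta> * (1 - ?u)"
    proof -
      have "exp (T - b) = exp (T - a) * exp (a - b)" by (simp flip: exp_add)
      moreover have "cis \<theta>' = cis \<theta> * cis (\<theta>' - \<theta>)" by (simp add: cis_mult)
      ultimately show ?thesis by (simp add: algebra_simps)
    qed
    then have "norm (of_real (exp (T - a)) * cis \<theta> - of_real (exp (T - b)) * cis \<theta>')
        = exp (T - a) * norm (1 - ?u)"
      by (simp add: norm_mult)
    also have "\<dots> \<le> exp (T - a) * (exp (1 - s) * norm (1 - of_real s * ?u))"
      using that assms by (intro mult_left_mono norm_one_minus_le_contracted) (auto simp: norm_mult)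
    finally show ?thesis by (simp add: exp_add)
  qed
  show ?thesis
  proof (cases "a \<le> b")
    case True
    \<comment> \<open>\<open>main\<close> yields the opposite difference of angles; conjugation
      reverses it without changing the norm.\<close>
    have "1 - of_real s * (of_real (exp (a - b)) * cis (\<theta>' - \<theta>)) =
        cnj (1 - of_real s * (of_real (exp (a - b)) * cis (\<theta> - \<theta>')))"
      by (simp add: cis_cnj)
    then have "norm (1 - of_real s * (of_real (exp (a - b)) * cis (\<theta>' - \<theta>))) =
        norm (1 - of_real s * (of_real (exp (a - b)) * cis (\<theta> - \<theta>')))"
      by (simp only: complex_mod_cnj)
    then show ?thesis using main[OF True, of \<theta> \<theta>'] True by (simp add: min_def)
  next
    case False
    then show ?thesis using main[of b a \<theta>' \<theta>] by (simp add: min_def norm_minus_commute)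
  qed
qed

text \<open>The energy estimate is turned into a bound for a product over ordered pairs. Adding the
  diagonal, where the contracted factor is \<open>1 - s\<close>, accounts for the terms with
  \<open>ln (1 - s)\<close> and with the sum of the \<open>t i\<close>. Every pair may lose
  \<open>1/2\<close> in the Poisson kernel, which costs the summand \<open>l\<close> next to
  \<open>T + (1 - s)\<close>; pairs of equal direction gain the last sum.\<close>

lemma prod_polar_dist_le:
  fixes t \<theta> :: "'a \<Rightarrow> real"
  assumes I: "finite I" and T: "0 \<le> T" and s: "0 < s" "s < 1" and l: "0 < l"
  defines "z \<equiv> \<lambda>i. of_real (exp (T - t i)) * cis (\<theta> i)"
  shows "(\<Prod>i\<in>I. \<Prod>j\<in>I - {i}. norm (z i - z j))
    \<le> exp ((real (card I))\<^sup>2 * (T + (1 - s) + l) - real (card I) * ln (1 - s) + (\<Sum>i\<in>I. t i)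
        - (\<Sum>i\<in>I. \<Sum>j\<in>I. min (t i) (t j))
        - 2 * l * (\<Sum>i\<in>I. \<Sum>j\<in>I. if \<theta> i = \<theta> j then 1 / (l - ln s + \<bar>t i - t j\<bar>) else 0))"
proof -
  define u where "u = (\<lambda>i j. of_real (exp (- \<bar>t i - t j\<bar>)) * cis (\<theta> i - \<theta> j))"
  define n where "n = (\<lambda>i j. norm (1 - of_real s * u i j))"
  define g where "g = (\<lambda>i j. T - min (t i) (t j) + (1 - s) + ln (n i j))"
  define v where "v = (\<lambda>i j. of_real (s * exp (- l)) * u i j)"
  have n0: "0 < n i j" for i j
  proof -
    have "norm (of_real s * u i j) \<le> s * 1"
      unfolding norm_mult using s by (intro mult_mono) (auto simp: u_def norm_mult)
    then have "of_real s * u i j \<noteq> 1" using s by auto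
    then show ?thesis by (auto simp: n_def)
  qed
  have nii: "n i i = 1 - s" for i
  proof -
    have "n i i = norm (of_real (1 - s) :: complex)" by (simp add: n_def u_def)
    then show ?thesis using s by (simp only: norm_of_real)
  qed
  have "(\<Prod>i\<in>I. \<Prod>j\<in>I - {i}. norm (z i - z j)) \<le> (\<Prod>i\<in>I. \<Prod>j\<in>I - {i}. exp (g i j))"
  proof (intro prod_mono conjI prod_nonneg norm_ge_zero ballI)
    fix i j
    show "norm (z i - z j) \<le> exp (g i j)"
      using norm_polar_diff_le[OF s, of T "t i" "\<theta> i" "t j" "\<theta> j"] n0[of i j]
      by (simp add: g_def z_def n_def u_def exp_add)
  qed
  also have "\<dots> = exp (\<Sum>i\<in>I. (\<Sum>j\<in>I. g i j) - g i i)"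
  proof -
    have "(\<Sum>i\<in>I. (\<Sum>j\<in>I. g i j) - g i i) = (\<Sum>i\<in>I. \<Sum>j\<in>I - {i}. g i j)"
      using I by (intro sum.cong) (auto simp: sum_diff1)
    then show ?thesis using I by (simp add: exp_sum)
  qed
  also have "\<dots> \<le> exp ((real (card I))\<^sup>2 * (T + (1 - s) + l) - real (card I) * ln (1 - s) + (\<Sum>i\<in>I. t i)
        - (\<Sum>i\<in>I. \<Sum>j\<in>I. min (t i) (t j))
        - 2 * l * (\<Sum>i\<in>I. \<Sum>j\<in>I. if \<theta> i = \<theta> j then 1 / (l - ln s + \<bar>t i - t j\<bar>) else 0))"
  proof -
    let ?N = "real (card I)"
    let ?y = "\<lambda>i j. if \<theta> i = \<theta> j then 1 / (l - ln s + \<bar>t i - t j\<bar>) else 0"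
    have v1: "norm (v i j) < 1" for i j
    proof -
      have "norm (v i j) \<le> s * exp (- l) * 1"
        unfolding v_def norm_mult using s by (intro mult_mono) (auto simp: u_def norm_mult)
      also have "\<dots> < 1" using s l mult_strict_mono[of s 1 "exp (- l)" 1] by simp
      finally show ?thesis .
    qed
    have "?y i j - 1 / 2 \<le> Re (v i j / (1 - v i j))" for i j
    proof (cases "\<theta> i = \<theta> j")
      case True
      let ?Y = "l - ln s + \<bar>t i - t j\<bar>"
      have "ln s < 0" using s by simp
      then have "0 < ?Y" using l by simp
      have "exp (- ?Y) = s * exp (- l) * exp (- \<bar>t i - t j\<bar>)"
      proof -
        have "exp (- ?Y) = exp (ln s) * exp (- l) * exp (- \<bar>t i - t j\<bar>)"
          by (simp flip: exp_add)
        then show ?thesis using s by simp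
      qed
      then have "v i j = of_real (exp (- ?Y))"
        using True by (simp add: v_def u_def)
      then have "v i j / (1 - v i j) = of_real (exp (- ?Y) / (1 - exp (- ?Y)))"
        by (simp only: of_real_divide of_real_diff of_real_1)
      then show ?thesis
        using geometric_exp_ge[OF \<open>0 < ?Y\<close>] True by (simp only: Re_complex_of_real refl if_True)
    next
      case False
      then show ?thesis using Re_geometric_ge[OF v1] by simp
    qed
    then have "(\<Sum>i\<in>I. \<Sum>j\<in>I. ?y i j - 1 / 2) \<le> (\<Sum>i\<in>I. \<Sum>j\<in>I. Re (v i j / (1 - v i j)))"
      by (intro sum_mono)
    then have "(\<Sum>i\<in>I. \<Sum>j\<in>I. ?y i j) - ?N\<^sup>2 / 2 \<le> (\<Sum>i\<in>I. \<Sum>j\<in>I. Re (v i j / (1 - v i j)))"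
      by (simp add: sum_subtractf power2_eq_square)
    then have "2 * l * ((\<Sum>i\<in>I. \<Sum>j\<in>I. ?y i j) - ?N\<^sup>2 / 2)
        \<le> 2 * l * (\<Sum>i\<in>I. \<Sum>j\<in>I. Re (v i j / (1 - v i j)))"
      using l by (intro mult_left_mono) auto
    moreover have "(\<Sum>i\<in>I. \<Sum>j\<in>I. ln (n i j)) \<le> - (2 * l * (\<Sum>i\<in>I. \<Sum>j\<in>I. Re (v i j / (1 - v i j))))"
      using log_energy_le[OF I s l, of t \<theta>] by (simp add: n_def u_def v_def mult.assoc)
    moreover have "(\<Sum>i\<in>I. (\<Sum>j\<in>I. g i j) - g i i) = ?N\<^sup>2 * (T + (1 - s))
        - (\<Sum>i\<in>I. \<Sum>j\<in>I. min (t i) (t j)) + (\<Sum>i\<in>I. \<Sum>j\<in>I. ln (n i j))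
        - ?N * (T + (1 - s)) - ?N * ln (1 - s) + (\<Sum>i\<in>I. t i)"
      by (simp add: g_def nii sum.distrib sum_subtractf power2_eq_square algebra_simps)
    moreover have "0 \<le> ?N * (T + (1 - s))" using T s by simp
    ultimately show ?thesis by (simp add: algebra_simps)
  qed
  finally show ?thesis .
qed

section \<open>Pairs on a common spine and the two-layer estimate\<close>

text \<open>Cauchy-Schwarz for the sizes of the fibres of \<open>\<theta>\<close>: the sum of their
  squares counts the ordered pairs of equal direction.\<close>

lemma card_sq_le_same_direction:
  fixes \<theta> :: "'a \<Rightarrow> real"
  assumes "finite S" "finite \<Theta>" "\<theta> ` S \<subseteq> \<Theta>" "real (card \<Theta>) \<le> n"
  shows "(real (card S))\<^sup>2 \<le> n * (\<Sum>i\<in>S. \<Sum>j\<in>S. of_bool (\<theta> i = \<theta> j))"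
proof -
  let ?c = "\<lambda>p. real (card {i \<in> S. \<theta> i = p})"
  have "real (card S) = (\<Sum>p\<in>\<Theta>. ?c p)"
    using sum.group[OF assms(1-3), of "\<lambda>_. 1::real"] by simp
  then have "(real (card S))\<^sup>2 \<le> (\<Sum>p\<in>\<Theta>. (?c p)\<^sup>2) * real (card \<Theta>)"
    using sum_squared_le_sum_of_squares[of ?c \<Theta>] by simp
  also have "\<dots> \<le> (\<Sum>p\<in>\<Theta>. (?c p)\<^sup>2) * n"
    using assms(4) by (intro mult_left_mono sum_nonneg) auto
  also have "(\<Sum>p\<in>\<Theta>. (?c p)\<^sup>2) = (\<Sum>p\<in>\<Theta>. \<Sum>i\<in>{i \<in> S. \<theta> i = p}. \<Sum>j\<in>S. of_bool (\<theta> i = \<theta> j))"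
  proof (intro sum.cong refl)
    fix p
    have "(\<Sum>j\<in>S. of_bool (p = \<theta> j)) = ?c p"
      using assms(1) by (simp add: sum.If_cases of_bool_def Int_def eq_commute)
    moreover have "(\<Sum>i\<in>{i \<in> S. \<theta> i = p}. \<Sum>j\<in>S. of_bool (\<theta> i = \<theta> j))
        = (\<Sum>i\<in>{i \<in> S. \<theta> i = p}. \<Sum>j\<in>S. of_bool (p = \<theta> j))"
      by (intro sum.cong) auto
    ultimately show "(?c p)\<^sup>2 = (\<Sum>i\<in>{i \<in> S. \<theta> i = p}. \<Sum>j\<in>S. of_bool (\<theta> i = \<theta> j))"
      by (simp add: power2_eq_square)
  qed
  also have "\<dots> = (\<Sum>i\<in>S. \<Sum>j\<in>S. of_bool (\<theta> i = \<theta> j))"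
    by (rule sum.group[OF assms(1-3)])
  finally show ?thesis by (simp add: mult.commute)
qed

lemma sum_sum_of_bool_mult:
  fixes f :: "'a \<Rightarrow> 'a \<Rightarrow> real"
  assumes "finite I" "S \<subseteq> I"
  shows "(\<Sum>i\<in>I. \<Sum>j\<in>I. of_bool (i \<in> S) * (of_bool (j \<in> S) * f i j)) = (\<Sum>i\<in>S. \<Sum>j\<in>S. f i j)"
proof -
  have "(\<Sum>i\<in>I. of_bool (i \<in> S) * h i) = sum h S" for h :: "'a \<Rightarrow> real"
    using assms by (intro sum.mono_neutral_cong_right) auto
  then show ?thesis by (simp flip: sum_distrib_left)
qed

text \<open>
  The variables are the numbers of points in the outer and in the inner part of the spines, and in
  the disc around the origin. The identity in the proof is an \<open>LDL\<^sup>T\<close> decomposition.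
\<close>

lemma two_layer_form_ge:
  fixes a b d :: real
  shows "36/100 * (a + b + d)\<^sup>2
    \<le> 29/100 * ((a + b)\<^sup>2 + 3/2 * a\<^sup>2 + 1/3 * b\<^sup>2) + (1/4 * (b + d)\<^sup>2 + 3/5 * d\<^sup>2)"
proof -
  have "29/100 * ((a + b)\<^sup>2 + 3/2 * a\<^sup>2 + 1/3 * b\<^sup>2) + (1/4 * (b + d)\<^sup>2 + 3/5 * d\<^sup>2)
      - 36/100 * (a + b + d)\<^sup>2
    = 73/200 * (a - 14/73 * b - 72/73 * d)\<^sup>2 + 1153/4380 * (b - 3921/5765 * d)\<^sup>2
      + 3793/288250 * d\<^sup>2"
    by (simp add: power2_eq_square field_simps)
  also have "\<dots> \<ge> 0" by simp
  finally show ?thesis by simp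
qed

text \<open>
  The constants are chosen by numerical optimisation. In units of \<open>1/n\<close>, the layers are cut at depths
  \<open>1/4\<close> and \<open>17/20\<close>, the weights use \<open>l = 0.145\<close> and the contraction factor is \<open>s = exp (- 0.005)\<close>, so
  that \<open>198 + 5 + 145 < 360\<close> is the inequality that makes the energy positive.
\<close>

lemma prod_hedgehog_dist_le:
  fixes x \<theta> :: "'a \<Rightarrow> real"
  assumes I: "finite I" and \<Theta>: "finite \<Theta>" "real (card \<Theta>) \<le> n" and n: "0 < n"
    and T: "0 \<le> T" "T \<le> 198/1000 / n"
    and x: "\<And>i. i \<in> I \<Longrightarrow> 0 \<le> x i" "\<And>i. i \<in> I \<Longrightarrow> x i \<le> 17/20"
    and dir: "\<And>i. i \<in> I \<Longrightarrow> x i < 17/20 \<Longrightarrow> \<theta> i \<in> \<Theta>"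
  defines "z \<equiv> \<lambda>i. of_real (exp (T - x i / n)) * cis (\<theta> i)"
  shows "(\<Prod>i\<in>I. \<Prod>j\<in>I - {i}. norm (z i - z j))
    \<le> exp (real (card I) * (17/20 / n - ln (1 - exp (- (1/200 / n)))) - 12/1000 / n * (real (card I))\<^sup>2)"
proof -
  define N where "N = real (card I)"
  define s where "s = exp (- (1/200 / n))"
  define l where "l = 145/1000 / n"
  have s: "0 < s" "s < 1" and l: "0 < l" using n by (auto simp: s_def l_def)
  \<comment> \<open>In units of \<open>1 / n\<close> the denominators of the energy sum thus become
    \<open>15/100\<close> plus the difference of depths.\<close>
  have ls: "l - ln s = 15/100 / n" by (simp add: l_def s_def)
  have s1: "1 - s \<le> 1/200 / n" using exp_ge_add_one_self[of "- (1/200 / n)"] by (simp add: s_def)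
  \<comment> \<open>\<open>A\<close> and \<open>B\<close> are the outer and inner layers of the
    spines. \<open>D\<close> consists of the points on the inner circle, whose direction is
    arbitrary, so it cannot enter the count of directions.\<close>
  define A where "A = {i \<in> I. x i \<le> 1/4}"
  define B where "B = {i \<in> I. 1/4 < x i \<and> x i < 17/20}"
  define D where "D = {i \<in> I. x i = 17/20}"
  have sub: "A \<subseteq> I" "B \<subseteq> I" "D \<subseteq> I" "A \<union> B \<subseteq> I" "B \<union> D \<subseteq> I"
    by (auto simp: A_def B_def D_def)
  have fin: "finite A" "finite B" "finite D" using sub I finite_subset by blast+
  have disj: "A \<inter> B = {}" "B \<inter> D = {}" "(A \<union> B) \<inter> D = {}" by (auto simp: A_def B_def D_def)
  have IABD: "I = A \<union> B \<union> D" using x by (force simp: A_def B_def D_def)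
  define a b d where "a = real (card A)" and "b = real (card B)" and "d = real (card D)"
  have N: "N = a + b + d"
    using fin disj unfolding N_def a_def b_def d_def by (subst IABD) (simp add: card_Un_disjoint)
  have cAB: "real (card (A \<union> B)) = a + b" and cBD: "real (card (B \<union> D)) = b + d"
    using fin disj unfolding a_def b_def d_def by (simp_all add: card_Un_disjoint)
  let ?e = "\<lambda>i j. of_bool (\<theta> i = \<theta> j) :: real"
  let ?w = "\<lambda>i j. if \<theta> i = \<theta> j then 1 / (l - ln s + \<bar>x i / n - x j / n\<bar>) else 0"
  let ?i = "\<lambda>S i j f. of_bool (i \<in> S) * (of_bool (j \<in> S) * f) :: real"
  have same: "(a + b)\<^sup>2 + 3/2 * a\<^sup>2 + 1/3 * b\<^sup>2 \<le> (\<Sum>i\<in>I. \<Sum>j\<in>I. ?w i j)"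
  proof -
    have dir': "\<theta> ` A \<subseteq> \<Theta>" "\<theta> ` B \<subseteq> \<Theta>" "\<theta> ` (A \<union> B) \<subseteq> \<Theta>"
      using dir by (auto simp: A_def B_def)
    have "(a + b)\<^sup>2 + 3/2 * a\<^sup>2 + 1/3 * b\<^sup>2 \<le>
        n * (\<Sum>i\<in>A \<union> B. \<Sum>j\<in>A \<union> B. ?e i j) + 3/2 * (n * (\<Sum>i\<in>A. \<Sum>j\<in>A. ?e i j))
        + 1/3 * (n * (\<Sum>i\<in>B. \<Sum>j\<in>B. ?e i j))"
      using card_sq_le_same_direction[OF _ \<Theta>(1) dir'(3) \<Theta>(2)]
        card_sq_le_same_direction[OF _ \<Theta>(1) dir'(1) \<Theta>(2)]
        card_sq_le_same_direction[OF _ \<Theta>(1) dir'(2) \<Theta>(2)] fin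
      unfolding cAB by (intro add_mono mult_left_mono) (auto simp: a_def b_def)
    also have "\<dots> = (\<Sum>i\<in>I. \<Sum>j\<in>I. n * (?i (A \<union> B) i j (?e i j) + 3/2 * ?i A i j (?e i j) + 1/3 * ?i B i j (?e i j)))"
      unfolding sum_sum_of_bool_mult[OF I sub(1), symmetric] sum_sum_of_bool_mult[OF I sub(2), symmetric]
        sum_sum_of_bool_mult[OF I sub(4), symmetric]
      by (simp only: sum.distrib sum_distrib_left distrib_left mult.left_commute[of n])
    also have "\<dots> \<le> (\<Sum>i\<in>I. \<Sum>j\<in>I. ?w i j)"
    proof (intro sum_mono)
      fix i j assume ij: "i \<in> I" "j \<in> I"
      let ?d = "\<bar>x i - x j\<bar>"
      have w: "?w i j = n * (?e i j * (1 / (15/100 + ?d)))"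
        using n by (simp add: ls divide_simps flip: diff_divide_distrib)
      \<comment> \<open>Depths differ by at most \<open>1/4\<close> within \<open>A\<close>,
        \<open>3/5\<close> within \<open>B\<close> and \<open>17/20\<close> across the layers, so
        the reciprocal is at least \<open>5/2 = 1 + 3/2\<close>, \<open>4/3 = 1 + 1/3\<close> and
        \<open>1\<close> respectively.\<close>
      have "of_bool (i \<in> A \<union> B) * of_bool (j \<in> A \<union> B) + 3/2 * (of_bool (i \<in> A) * of_bool (j \<in> A))
          + 1/3 * (of_bool (i \<in> B) * of_bool (j \<in> B)) \<le> 1 / (15/100 + ?d)"
      proof -
        consider "i \<in> A" "j \<in> A" | "i \<in> B" "j \<in> B" | "i \<in> A" "j \<in> B" | "i \<in> B" "j \<in> A" | "i \<in> D" | "j \<in> D"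
          using ij IABD by blast
        then show ?thesis
        proof cases
          case 1
          then have "15/100 + ?d \<le> 2/5" using x(1)[OF ij(1)] x(1)[OF ij(2)] by (auto simp: A_def abs_if)
          then have "5/2 \<le> 1 / (15/100 + ?d)" using frac_le[of 1 1 "15/100 + ?d" "2/5"] by (simp add: add_pos_nonneg)
          then show ?thesis using 1 disj by auto
        next
          case 2
          then have "15/100 + ?d \<le> 3/4" using x(1)[OF ij(1)] x(1)[OF ij(2)] by (auto simp: B_def abs_if)
          then have "4/3 \<le> 1 / (15/100 + ?d)"
            using frac_le[of 1 1 "15/100 + ?d" "3/4"] by (simp add: add_pos_nonneg)
          then show ?thesis using 2 disj by auto
        next
          case 3
          then have "15/100 + ?d \<le> 1" using x(1)[OF ij(1)] x(1)[OF ij(2)] by (auto simp: B_def A_def abs_if)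
          then have "1 \<le> 1 / (15/100 + ?d)"
            using frac_le[of 1 1 "15/100 + ?d" 1] by (simp add: add_pos_nonneg)
          then show ?thesis using 3 disj by auto
        next
          case 4
          then have "15/100 + ?d \<le> 1" using x(1)[OF ij(1)] x(1)[OF ij(2)] by (auto simp: B_def A_def abs_if)
          then have "1 \<le> 1 / (15/100 + ?d)"
            using frac_le[of 1 1 "15/100 + ?d" 1] by (simp add: add_pos_nonneg)
          then show ?thesis using 4 disj by auto
        qed (use disj in auto)
      qed
      then show "n * (?i (A \<union> B) i j (?e i j) + 3/2 * ?i A i j (?e i j) + 1/3 * ?i B i j (?e i j)) \<le> ?w i j"
        unfolding w using n by (intro mult_left_mono) (cases "\<theta> i = \<theta> j", auto)
    qed
    finally show ?thesis .
  qed
  \<comment> \<open>Depths exceed \<open>1/4\<close> on \<open>B \<union> D\<close> and equal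
    \<open>17/20 = 1/4 + 3/5\<close> on \<open>D\<close>, so the minimum dominates a combination of
    two block indicators.\<close>
  have mins: "1/4 * (b + d)\<^sup>2 + 3/5 * d\<^sup>2 \<le> (\<Sum>i\<in>I. \<Sum>j\<in>I. min (x i) (x j))"
  proof -
    have "1/4 * (b + d)\<^sup>2 + 3/5 * d\<^sup>2 =
        1/4 * (\<Sum>i\<in>B \<union> D. \<Sum>j\<in>B \<union> D. 1) + 3/5 * (\<Sum>i\<in>D. \<Sum>j\<in>D. 1)"
      using cBD by (simp add: power2_eq_square d_def flip: of_nat_mult)
    also have "\<dots> = (\<Sum>i\<in>I. \<Sum>j\<in>I. 1/4 * ?i (B \<union> D) i j 1 + 3/5 * ?i D i j 1)"
      unfolding sum_sum_of_bool_mult[OF I sub(5), symmetric] sum_sum_of_bool_mult[OF I sub(3), symmetric]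
      by (simp only: sum.distrib sum_distrib_left)
    also have "\<dots> \<le> (\<Sum>i\<in>I. \<Sum>j\<in>I. min (x i) (x j))"
      using x by (intro sum_mono) (auto simp: B_def D_def of_bool_def min_def)
    finally show ?thesis .
  qed
  have tsum: "(\<Sum>i\<in>I. x i / n) \<le> N * (17/20 / n)"
    unfolding N_def by (intro sum_bounded_above divide_right_mono x(2)) (use n in auto)
  have minn: "(\<Sum>i\<in>I. \<Sum>j\<in>I. min (x i / n) (x j / n)) = (\<Sum>i\<in>I. \<Sum>j\<in>I. min (x i) (x j)) / n"
    using n unfolding sum_divide_distrib by (intro sum.cong refl) (auto simp: min_def divide_simps)
  have "N\<^sup>2 * (T + (1 - s) + l) - N * ln (1 - s) + (\<Sum>i\<in>I. x i / n)
        - (\<Sum>i\<in>I. \<Sum>j\<in>I. min (x i / n) (x j / n)) - 2 * l * (\<Sum>i\<in>I. \<Sum>j\<in>I. ?w i j)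
      \<le> N\<^sup>2 * (348/1000 / n) - N * ln (1 - s) + N * (17/20 / n)
        - (1/4 * (b + d)\<^sup>2 + 3/5 * d\<^sup>2) / n - 29/100 / n * ((a + b)\<^sup>2 + 3/2 * a\<^sup>2 + 1/3 * b\<^sup>2)"
  proof -
    have "N\<^sup>2 * (T + (1 - s) + l) \<le> N\<^sup>2 * (348/1000 / n)"
      using T s1 by (intro mult_left_mono) (auto simp: l_def add_divide_distrib[symmetric] field_simps)
    moreover have "(1/4 * (b + d)\<^sup>2 + 3/5 * d\<^sup>2) / n \<le> (\<Sum>i\<in>I. \<Sum>j\<in>I. min (x i) (x j)) / n"
      using mins n by (intro divide_right_mono) auto
    moreover have "2 * l * ((a + b)\<^sup>2 + 3/2 * a\<^sup>2 + 1/3 * b\<^sup>2) \<le> 2 * l * (\<Sum>i\<in>I. \<Sum>j\<in>I. ?w i j)"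
      using same l by (intro mult_left_mono) auto
    moreover have "2 * l * ((a + b)\<^sup>2 + 3/2 * a\<^sup>2 + 1/3 * b\<^sup>2)
        = 29/100 / n * ((a + b)\<^sup>2 + 3/2 * a\<^sup>2 + 1/3 * b\<^sup>2)"
      by (simp add: l_def)
    ultimately show ?thesis using tsum unfolding minn by (smt (verit))
  qed
  \<comment> \<open>The quadratic form supplies \<open>36/100\<close>; \<open>T\<close>, the
    contraction and \<open>l\<close> together consume \<open>348/1000\<close>, which leaves
    \<open>12/1000\<close>.\<close>
  also have "\<dots> \<le> N * (17/20 / n - ln (1 - s)) - 12/1000 / n * N\<^sup>2"
  proof -
    have "36/100 * N\<^sup>2 / n \<le> (29/100 * ((a + b)\<^sup>2 + 3/2 * a\<^sup>2 + 1/3 * b\<^sup>2) + (1/4 * (b + d)\<^sup>2 + 3/5 * d\<^sup>2)) / n"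
      using two_layer_form_ge[of a b d] n unfolding N by (intro divide_right_mono) auto
    then show ?thesis by (simp add: algebra_simps add_divide_distrib)
  qed
  finally show ?thesis
    using prod_polar_dist_le[OF I T(1) s l, of "\<lambda>i. x i / n" \<theta>]
    unfolding z_def N_def s_def by (smt (verit, best) exp_le_cancel_iff)
qed

section \<open>Hankel determinants\<close>

lemma det_mat:
  "det (mat n n f) = (\<Sum>p | p permutes {0..<n}. signof p * (\<Prod>i = 0..<n. f (i, p i)))"
proof -
  have "p i < n" if "p permutes {0..<n}" "i < n" for p i
    using permutes_in_image[OF that(1), of i] that(2) by simp
  then show ?thesis
    by (subst det_def'[of _ n]) (auto intro!: sum.cong prod.cong)
qed

text \<open>Multiplication by the coefficient matrix of the Newton polynomials \<open>P j\<close>,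
  which is unitriangular because they are monic of degree \<open>j\<close>, turns the powers of
  \<open>z i\<close> into the values of \<open>P j\<close> at \<open>z i\<close>. These vanish for
  \<open>i < j\<close>, so the product is triangular.\<close>

lemma det_vandermonde:
  fixes z :: "nat \<Rightarrow> 'a :: idom"
  shows "det (mat n n (\<lambda>(i, j). z i ^ j)) = (\<Prod>i<n. \<Prod>j<i. z i - z j)"
proof -
  define P where "P = (\<lambda>j. \<Prod>m<j. [:- z m, 1:])"
  have deg: "degree (P j) = j" for j
    unfolding P_def by (subst degree_prod_eq_sum_degree) auto
  have lead: "coeff (P j) j = 1" for j
    using lead_coeff_prod[of "\<lambda>m. [:- z m, 1:]" "{..<j}"] deg[of j] by (simp add: P_def)
  let ?A = "mat n n (\<lambda>(i, j). z i ^ j)" and ?C = "mat n n (\<lambda>(k, j). coeff (P j) k)"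
  have "det ?C = prod_list (diag_mat ?C)"
    by (rule det_upper_triangular) (auto intro!: coeff_eq_0 simp: upper_triangular_def deg)
  also have "\<dots> = 1"
    by (simp add: diag_mat_def prod.distinct_set_conv_list[symmetric] lead)
  finally have C: "det ?C = 1" .
  have "?A * ?C = mat n n (\<lambda>(i, j). poly (P j) (z i))"
  proof (rule eq_matI)
    fix i j assume "i < dim_row (mat n n (\<lambda>(i, j). poly (P j) (z i)))"
      "j < dim_col (mat n n (\<lambda>(i, j). poly (P j) (z i)))"
    then have ij: "i < n" "j < n" by auto
    have "(?A * ?C) $$ (i, j) = (\<Sum>k<n. coeff (P j) k * z i ^ k)"
      using ij by (simp add: scalar_prod_def lessThan_atLeast0 mult.commute)
    also have "\<dots> = (\<Sum>k\<le>j. coeff (P j) k * z i ^ k)"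
      using ij by (intro sum.mono_neutral_right) (auto intro!: coeff_eq_0 simp: deg)
    also have "\<dots> = poly (P j) (z i)" by (simp add: poly_altdef deg)
    finally show "(?A * ?C) $$ (i, j) = mat n n (\<lambda>(i, j). poly (P j) (z i)) $$ (i, j)"
      using ij by simp
  qed auto
  then have "det ?A * det ?C = det (mat n n (\<lambda>(i, j). poly (P j) (z i)))"
    by (subst det_mult[symmetric]) auto
  also have "\<dots> = prod_list (diag_mat (mat n n (\<lambda>(i, j). poly (P j) (z i))))"
    by (rule det_lower_triangular[of n]) (auto simp: P_def poly_prod)
  also have "\<dots> = (\<Prod>i<n. poly (P i) (z i))"
    by (simp add: diag_mat_def prod.distinct_set_conv_list[symmetric] lessThan_atLeast0)
  finally show ?thesis unfolding C by (simp add: P_def poly_prod)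
qed

lemma norm_det_vandermonde_sq:
  fixes z :: "nat \<Rightarrow> complex"
  shows "(norm (det (mat n n (\<lambda>(i, j). z i ^ j))))\<^sup>2 = (\<Prod>i<n. \<Prod>j\<in>{..<n} - {i}. norm (z i - z j))"
proof -
  have "(\<Prod>i<n. \<Prod>j\<in>{..<n} - {i}. norm (z i - z j))
      = (\<Prod>i<n. (\<Prod>j<i. norm (z i - z j)) * (\<Prod>j\<in>{i<..<n}. norm (z i - z j)))"
  proof (intro prod.cong refl)
    fix i assume "i \<in> {..<n}"
    then have "{..<n} - {i} = {..<i} \<union> {i<..<n}" by auto
    moreover have "{..<i} \<inter> {i<..<n} = {}" by auto
    ultimately show "(\<Prod>j\<in>{..<n} - {i}. norm (z i - z j))
        = (\<Prod>j<i. norm (z i - z j)) * (\<Prod>j\<in>{i<..<n}. norm (z i - z j))"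
      by (simp add: prod.union_disjoint)
  qed
  also have "\<dots> = (\<Prod>i<n. \<Prod>j<i. norm (z i - z j)) * (\<Prod>i<n. \<Prod>j\<in>{i<..<n}. norm (z i - z j))"
    by (simp add: prod.distrib)
  also have "(\<Prod>i<n. \<Prod>j\<in>{i<..<n}. norm (z i - z j)) = (\<Prod>j<n. \<Prod>i<j. norm (z i - z j))"
    unfolding prod.Sigma[OF finite_lessThan ballI[OF finite_greaterThanLessThan]]
      prod.Sigma[OF finite_lessThan ballI[OF finite_lessThan]]
    by (rule prod.reindex_bij_witness[of _ "\<lambda>(a, b). (b, a)" "\<lambda>(a, b). (b, a)"]) auto
  also have "\<dots> = (\<Prod>i<n. \<Prod>j<i. norm (z i - z j))"
    by (simp add: norm_minus_commute)
  finally show ?thesis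
    by (simp add: det_vandermonde norm_mult prod_norm power2_eq_square)
qed

definition hankel_mat :: "(nat \<Rightarrow> 'a) \<Rightarrow> nat \<Rightarrow> 'a mat" where
  "hankel_mat a n = mat n n (\<lambda>(i, j). a (i + j))"

text \<open>
  The symmetrised form produces the square of a Vandermonde determinant when \<open>a k\<close> is replaced by \<open>z ^ k\<close>.
\<close>

lemma fact_det_hankel_mat:
  fixes a :: "nat \<Rightarrow> 'a :: comm_ring_1"
  shows "of_nat (fact n) * det (hankel_mat a n) =
    (\<Sum>p | p permutes {0..<n}. \<Sum>q | q permutes {0..<n}. signof p * signof q * (\<Prod>i = 0..<n. a (p i + q i)))"
proof -
  let ?P = "{p. p permutes {0..<n}}"
  \<comment> \<open>For fixed \<open>p\<close> the inner sum is already the determinant: reindex by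
    \<open>q\<close> composed with the inverse of \<open>p\<close> and permute the factors by
    \<open>p\<close>. Hence the factor \<open>fact n\<close>.\<close>
  have "(\<Sum>q\<in>?P. signof p * signof q * (\<Prod>i = 0..<n. a (p i + q i))) = det (hankel_mat a n)"
    if p: "p \<in> ?P" for p
  proof -
    have "det (hankel_mat a n) = (\<Sum>q\<in>?P. signof q * (\<Prod>i = 0..<n. a (i + q i)))"
      by (simp add: hankel_mat_def det_mat)
    also have "\<dots> = (\<Sum>q\<in>?P. signof (q \<circ> Hilbert_Choice.inv p) * (\<Prod>i = 0..<n. a (i + (q \<circ> Hilbert_Choice.inv p) i)))"
      using p by (intro sum_over_permutations_insert sum_permutations_compose_right) (auto intro: permutes_inv)
    also have "\<dots> = (\<Sum>q\<in>?P. signof p * signof q * (\<Prod>i = 0..<n. a (p i + q i)))"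
    proof (intro sum.cong refl arg_cong2[of _ _ _ _ "(*)"])
      fix q assume q: "q \<in> ?P"
      have pp: "permutation p" "permutation q" "permutation (Hilbert_Choice.inv p)"
        using p q permutation_permutes permutation_inverse by blast+
      show "signof (q \<circ> Hilbert_Choice.inv p) = (signof p * signof q :: 'a)"
        using pp by (simp add: sign_compose sign_inverse mult.commute)
      have "(\<Prod>i = 0..<n. a (i + (q \<circ> Hilbert_Choice.inv p) i)) = (\<Prod>i = 0..<n. a (p i + (q \<circ> Hilbert_Choice.inv p) (p i)))"
        using p prod.permute[of p "{0..<n}" "\<lambda>i. a (i + (q \<circ> Hilbert_Choice.inv p) i)"] by (simp add: o_def)
      then show "(\<Prod>i = 0..<n. a (i + (q \<circ> Hilbert_Choice.inv p) i)) = (\<Prod>i = 0..<n. a (p i + q i))"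
        using p by (simp add: permutes_inverses)
    qed
    finally show ?thesis by simp
  qed
  then show ?thesis by (simp add: card_permutations)
qed

text \<open>The functional sending \<open>z ^ k\<close> to \<open>a k\<close> is bounded by
  \<open>B\<close> times the supremum on \<open>E\<close>. It is applied to one variable at a time,
  with the others frozen at points of \<open>E\<close>, and each application costs a factor
  \<open>B\<close>.\<close>

lemma norm_multilinear_moments_le:
  fixes a :: "nat \<Rightarrow> complex"
  assumes mom: "\<And>M c S. (\<And>z. z \<in> E \<Longrightarrow> norm (\<Sum>k\<le>M. c k * z ^ k) \<le> S) \<Longrightarrow> norm (\<Sum>k\<le>M. c k * a k) \<le> B * S"
    and X: "finite X"
    and S: "\<And>z. (\<And>i. i < n \<Longrightarrow> z i \<in> E) \<Longrightarrow> norm (\<Sum>x\<in>X. c x * (\<Prod>i<n. z i ^ e x i)) \<le> S"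
  shows "norm (\<Sum>x\<in>X. c x * (\<Prod>i<n. a (e x i))) \<le> B ^ n * S"
  using S
proof (induction n arbitrary: c S)
  case 0
  then show ?case by simp
next
  case (Suc n)
  have "norm (\<Sum>x\<in>X. (c x * a (e x n)) * (\<Prod>i<n. a (e x i))) \<le> B ^ n * (B * S)"
  proof (rule Suc.IH)
    fix z :: "nat \<Rightarrow> complex" assume z: "\<And>i. i < n \<Longrightarrow> z i \<in> E"
    let ?d = "\<lambda>x. c x * (\<Prod>i<n. z i ^ e x i)"
    define M where "M = Max (insert 0 ((\<lambda>x. e x n) ` X))"
    have M: "(\<lambda>x. e x n) ` X \<subseteq> {..M}"
      using X by (auto simp: M_def intro!: Max_ge)
    \<comment> \<open>Grouping the terms by the exponent of the last variable exhibits a polynomial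
      in it, to which \<open>mom\<close> applies.\<close>
    have grp: "(\<Sum>k\<le>M. (\<Sum>x | x \<in> X \<and> e x n = k. ?d x) * f k) = (\<Sum>x\<in>X. ?d x * f (e x n))"
      for f :: "nat \<Rightarrow> complex"
      by (subst sum.group[OF X _ M, symmetric]) (auto simp: sum_distrib_right intro!: sum.cong)
    have "norm (\<Sum>k\<le>M. (\<Sum>x | x \<in> X \<and> e x n = k. ?d x) * a k) \<le> B * S"
    proof (rule mom)
      fix w assume "w \<in> E"
      then have "norm (\<Sum>x\<in>X. c x * (\<Prod>i<Suc n. (z(n := w)) i ^ e x i)) \<le> S"
        using z by (intro Suc.prems) (auto simp: less_Suc_eq)
      then show "norm (\<Sum>k\<le>M. (\<Sum>x | x \<in> X \<and> e x n = k. ?d x) * w ^ k) \<le> S"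
        unfolding grp by (simp add: mult.assoc)
    qed
    then show "norm (\<Sum>x\<in>X. c x * a (e x n) * (\<Prod>i<n. z i ^ e x i)) \<le> B * S"
      unfolding grp by (simp add: mult_ac)
  qed
  then show ?case by (simp add: mult_ac)
qed

text \<open>By the symmetrised formula, \<open>fact n\<close> times the determinant arises from the
  squared Vandermonde determinant by applying the moment functional in every variable. The norm of
  that square is the product of all mutual distances, and \<open>fact n \<ge> 1\<close>.\<close>

lemma norm_det_hankel_mat_le:
  fixes a :: "nat \<Rightarrow> complex"
  assumes mom: "\<And>M c S. (\<And>z. z \<in> E \<Longrightarrow> norm (\<Sum>k\<le>M. c k * z ^ k) \<le> S) \<Longrightarrow> norm (\<Sum>k\<le>M. c k * a k) \<le> B * S"
    and S: "\<And>z. (\<And>i. i < n \<Longrightarrow> z i \<in> E) \<Longrightarrow> (\<Prod>i<n. \<Prod>j\<in>{..<n} - {i}. norm (z i - z j)) \<le> S"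
  shows "norm (det (hankel_mat a n)) \<le> B ^ n * S"
proof -
  let ?P = "{p. p permutes {0..<n}}"
  let ?c = "\<lambda>x. signof (fst x) * signof (snd x) :: complex" and ?e = "\<lambda>x i. fst x i + snd x i"
  have "norm (\<Sum>x\<in>?P \<times> ?P. ?c x * (\<Prod>i<n. a (?e x i))) \<le> B ^ n * S"
  proof (rule norm_multilinear_moments_le[OF mom])
    show "finite (?P \<times> ?P)" by (simp add: finite_permutations)
    fix z :: "nat \<Rightarrow> complex" assume z: "\<And>i. i < n \<Longrightarrow> z i \<in> E"
    let ?V = "det (mat n n (\<lambda>(i, j). z i ^ j))"
    have "?V = (\<Sum>p\<in>?P. signof p * (\<Prod>i = 0..<n. z i ^ p i))"
      by (simp add: det_mat)
    then have "?V * ?V = (\<Sum>p\<in>?P. \<Sum>q\<in>?P. signof p * signof q * (\<Prod>i<n. z i ^ (p i + q i)))"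
      by (simp add: sum_product power_add prod.distrib lessThan_atLeast0 mult_ac)
    then have "(\<Sum>x\<in>?P \<times> ?P. ?c x * (\<Prod>i<n. z i ^ ?e x i)) = ?V * ?V"
      by (simp add: sum.cartesian_product split_beta)
    then show "norm (\<Sum>x\<in>?P \<times> ?P. ?c x * (\<Prod>i<n. z i ^ ?e x i)) \<le> S"
      using S[OF z] norm_det_vandermonde_sq[of n z] by (simp add: norm_mult power2_eq_square)
  qed
  also have "(\<Sum>x\<in>?P \<times> ?P. ?c x * (\<Prod>i<n. a (?e x i))) = of_nat (fact n) * det (hankel_mat a n)"
    unfolding fact_det_hankel_mat by (simp add: sum.cartesian_product split_beta lessThan_atLeast0)
  finally have "real (fact n) * norm (det (hankel_mat a n)) \<le> B ^ n * S"
    by (simp add: norm_mult del: of_nat_fact)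
  moreover have "1 * norm (det (hankel_mat a n)) \<le> real (fact n) * norm (det (hankel_mat a n))"
    by (intro mult_right_mono) (auto simp: fact_ge_1)
  ultimately show ?thesis by simp
qed

section \<open>Pade approximants and Kronecker's rationality criterion\<close>

lemma fps_mult_nth_zero_below:
  fixes f g :: "'a :: comm_ring_1 fps"
  assumes "\<And>k. k < m \<Longrightarrow> fps_nth g k = 0" "k < m"
  shows "fps_nth (f * g) k = 0"
  unfolding fps_mult_nth by (intro sum.neutral) (use assms in auto)

text \<open>A kernel vector of the Hankel matrix, read backwards, is the denominator of a Pade
  approximant: the entries of the matrix-vector product are the coefficients of \<open>q * f\<close>
  from \<open>N - 1\<close> to \<open>2 * N - 2\<close>. The numerator is the part of
  \<open>q * f\<close> below \<open>N - 1\<close>. Its bound is stated by coefficients because for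
  \<open>N = 1\<close> it says \<open>r = 0\<close>, which no degree bound expresses.\<close>

lemma hankel_kernel_pade:
  fixes f :: "'a :: field fps"
  assumes "det (hankel_mat (fps_nth f) N) = 0" and "0 < N"
  obtains q r where "q \<noteq> 0" "degree q < N" "\<And>k. N - 1 \<le> k \<Longrightarrow> coeff r k = 0"
    "\<And>k. k < 2 * N - 1 \<Longrightarrow> fps_nth (fps_of_poly q * f - fps_of_poly r) k = 0"
proof -
  obtain v where v: "v \<in> carrier_vec N" "v \<noteq> 0\<^sub>v N" "hankel_mat (fps_nth f) N *\<^sub>v v = 0\<^sub>v N"
    using assms(1) det_0_iff_vec_prod_zero[of "hankel_mat (fps_nth f) N" N]
    by (auto simp: hankel_mat_def)
  have Hv: "(\<Sum>j<N. fps_nth f (i + j) * v $ j) = 0" if "i < N" for i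
  proof -
    have "(\<Sum>j<N. fps_nth f (i + j) * v $ j) = (hankel_mat (fps_nth f) N *\<^sub>v v) $ i"
      using that v(1) by (simp add: hankel_mat_def scalar_prod_def lessThan_atLeast0)
    then show ?thesis using that by (simp add: v(3))
  qed
  define q where "q = (\<Sum>j<N. monom (v $ j) (N - 1 - j))"
  define r where "r = (\<Sum>k<N - 1. monom (fps_nth (fps_of_poly q * f) k) k)"
  have cq: "coeff q m = (if m < N then v $ (N - 1 - m) else 0)" for m
  proof -
    have "coeff q m = (\<Sum>j<N. if j = N - 1 - m \<and> m < N then v $ j else 0)"
      unfolding q_def coeff_sum coeff_monom by (intro sum.cong) auto
    also have "\<dots> = (if m < N then v $ (N - 1 - m) else 0)"
      by (cases "m < N") (auto simp: sum.delta)
    finally show ?thesis .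
  qed
  have cr: "coeff r k = (if k < N - 1 then fps_nth (fps_of_poly q * f) k else 0)" for k
    unfolding r_def coeff_sum coeff_monom by (simp add: sum.delta)
  show thesis
  proof (rule that[of q r])
    obtain j where j: "j < N" "v $ j \<noteq> 0"
      using v(1,2) by (metis eq_vecI carrier_vecD index_zero_vec)
    then have "coeff q (N - 1 - j) \<noteq> 0" by (simp add: cq)
    then show "q \<noteq> 0" by auto
    show "degree q < N"
      using assms(2) degree_le[of "N - 1" q] by (force simp: cq)
    show "coeff r k = 0" if "N - 1 \<le> k" for k using that by (simp add: cr)
    show "fps_nth (fps_of_poly q * f - fps_of_poly r) k = 0" if k: "k < 2 * N - 1" for k
    proof (cases "k < N - 1")
      case True
      then show ?thesis by (simp add: cr)
    next
      case False
      define i where "i = k - (N - 1)"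
      have i: "k = N - 1 + i" "i < N" using False k assms(2) by (auto simp: i_def)
      have "fps_nth (fps_of_poly q * f) k = (\<Sum>m=0..k. coeff q m * fps_nth f (k - m))"
        by (simp add: fps_mult_nth)
      also have "\<dots> = (\<Sum>m<N. v $ (N - 1 - m) * fps_nth f (k - m))"
        using False assms(2) by (intro sum.mono_neutral_cong_right) (auto simp: cq)
      also have "\<dots> = (\<Sum>j<N. fps_nth f (i + j) * v $ j)"
        by (rule sum.reindex_bij_witness[of _ "\<lambda>j. N - 1 - j" "\<lambda>j. N - 1 - j"])
          (auto simp: i mult.commute add.commute[of N])
      finally show ?thesis using False Hv[OF i(2)] by (simp add: cr)
    qed
  qed
qed

text \<open>All the approximants are the same fraction: the cross difference of two consecutive ones
  vanishes below index \<open>2 * N - 1\<close>, but has degree at most \<open>2 * N - 2\<close>. A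
  single fraction therefore approximates \<open>f\<close> to every order.\<close>

lemma rational_if_hankel_eventually_singular:
  fixes f :: "'a :: field fps"
  assumes "\<And>N. N0 \<le> N \<Longrightarrow> det (hankel_mat (fps_nth f) N) = 0"
  obtains q r where "q \<noteq> 0" "fps_of_poly q * f = fps_of_poly r"
proof -
  \<comment> \<open>The shift guarantees \<open>0 < N\<close>, which the construction of the
    approximants requires.\<close>
  define N1 where "N1 = Suc N0"
  have "\<forall>N. \<exists>q r. N1 \<le> N \<longrightarrow> q \<noteq> 0 \<and> degree q < N \<and> (\<forall>k\<ge>N - 1. coeff r k = 0) \<and>
      (\<forall>k<2 * N - 1. fps_nth (fps_of_poly q * f - fps_of_poly r) k = 0)"
  proof
    fix N
    show "\<exists>q r. N1 \<le> N \<longrightarrow> q \<noteq> 0 \<and> degree q < N \<and> (\<forall>k\<ge>N - 1. coeff r k = 0) \<and>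
      (\<forall>k<2 * N - 1. fps_nth (fps_of_poly q * f - fps_of_poly r) k = 0)"
    proof (cases "N1 \<le> N")
      case True
      then have "det (hankel_mat (fps_nth f) N) = 0" "0 < N" using assms by (auto simp: N1_def)
      then show ?thesis using hankel_kernel_pade by metis
    qed blast
  qed
  then obtain q r where q0: "\<And>N. N1 \<le> N \<Longrightarrow> q N \<noteq> 0" and dq: "\<And>N. N1 \<le> N \<Longrightarrow> degree (q N) < N"
    and cr: "\<And>N k. N1 \<le> N \<Longrightarrow> N - 1 \<le> k \<Longrightarrow> coeff (r N) k = 0"
    and ap: "\<And>N k. N1 \<le> N \<Longrightarrow> k < 2 * N - 1 \<Longrightarrow> fps_nth (fps_of_poly (q N) * f - fps_of_poly (r N)) k = 0"
    by metis
  have step: "q N * r (Suc N) = q (Suc N) * r N" if N: "N1 \<le> N" for N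
  proof (rule poly_eqI)
    fix k
    have N1: "1 \<le> N" using N by (simp add: N1_def)
    show "coeff (q N * r (Suc N)) k = coeff (q (Suc N) * r N) k"
    proof (cases "k < 2 * N - 1")
      case True
      let ?E = "\<lambda>N. fps_of_poly (q N) * f - fps_of_poly (r N)"
      have "fps_of_poly (q N * r (Suc N)) - fps_of_poly (q (Suc N) * r N)
          = fps_of_poly (q (Suc N)) * ?E N - fps_of_poly (q N) * ?E (Suc N)"
        by (simp add: fps_of_poly_mult algebra_simps)
      moreover have "fps_nth (fps_of_poly (q (Suc N)) * ?E N) k = 0"
        by (rule fps_mult_nth_zero_below[OF ap[OF N] True])
      moreover have "fps_nth (fps_of_poly (q N) * ?E (Suc N)) k = 0"
        by (rule fps_mult_nth_zero_below[of "2 * Suc N - 1"]) (use N True ap[of "Suc N"] in auto)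
      ultimately have "fps_nth (fps_of_poly (q N * r (Suc N)) - fps_of_poly (q (Suc N) * r N)) k = 0"
        by simp
      then show ?thesis by simp
    next
      case False
      have "coeff (q N) i * coeff (r (Suc N)) (k - i) = 0" for i
      proof (cases "i < N")
        case True
        then have "Suc N - 1 \<le> k - i" using False by simp
        then show ?thesis using cr[of "Suc N" "k - i"] N by simp
      next
        case False
        then show ?thesis using dq[OF N] by (simp add: coeff_eq_0)
      qed
      moreover have "coeff (q (Suc N)) i * coeff (r N) (k - i) = 0" for i
      proof (cases "i < Suc N")
        case True
        then have "N - 1 \<le> k - i" using False by simp
        then show ?thesis using cr[OF N] by simp
      next
        case False
        then show ?thesis using dq[of "Suc N"] N by (simp add: coeff_eq_0)
      qed
      ultimately show ?thesis by (simp only: coeff_mult sum.neutral_const)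
    qed
  qed
  have cross: "q N * r N1 = q N1 * r N" if "N1 \<le> N" for N
    using that
  proof (induction rule: dec_induct)
    case (step n)
    have "q n * (q (Suc n) * r N1) = q (Suc n) * (q n * r N1)" by (simp add: mult_ac)
    also have "\<dots> = q N1 * (q (Suc n) * r n)" using step by (simp add: mult_ac)
    also have "\<dots> = q n * (q N1 * r (Suc n))" using \<open>\<And>N. N1 \<le> N \<Longrightarrow> q N * r (Suc N) = q (Suc N) * r N\<close>[of n] step
      by (metis mult.left_commute)
    finally show ?case using q0[of n] step by simp
  qed simp
  let ?D = "fps_of_poly (q N1) * f - fps_of_poly (r N1)"
  \<comment> \<open>Otherwise \<open>q N\<close> times \<open>?D\<close> has order at least
    \<open>2 * N - 1\<close>, of which \<open>q N\<close> accounts for less than \<open>N\<close>; a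
    large \<open>N\<close> contradicts the fixed order of \<open>?D\<close>.\<close>
  have "?D = 0"
  proof (rule ccontr)
    assume D: "?D \<noteq> 0"
    define N where "N = max N1 (Suc (subdegree ?D))"
    have N: "N1 \<le> N" "subdegree ?D < N" by (auto simp: N_def)
    have "fps_of_poly (q N) * ?D = fps_of_poly (q N1) * (fps_of_poly (q N) * f - fps_of_poly (r N))"
    proof -
      have "fps_of_poly (q N) * fps_of_poly (r N1) = fps_of_poly (q N1) * fps_of_poly (r N)"
        using cross[OF N(1)] by (simp flip: fps_of_poly_mult)
      then show ?thesis by (simp add: algebra_simps)
    qed
    then have "fps_nth (fps_of_poly (q N) * ?D) k = 0" if "k < 2 * N - 1" for k
      using fps_mult_nth_zero_below[OF ap[OF N(1)] that] by simp
    moreover have qN: "fps_of_poly (q N) \<noteq> 0" using q0[OF N(1)] by simp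
    ultimately have "2 * N - 1 \<le> subdegree (fps_of_poly (q N) * ?D)"
      using D by (intro subdegree_geI) auto
    also have "\<dots> = subdegree (fps_of_poly (q N)) + subdegree ?D"
      using D qN by (rule subdegree_mult[rotated])
    also have "subdegree (fps_of_poly (q N)) \<le> degree (q N)"
      using q0[OF N(1)] by (intro subdegree_leI) simp
    finally show False using dq[OF N(1)] N(2) by linarith
  qed
  then show thesis using that[of "q N1" "r N1"] q0[of N1] by simp
qed

section \<open>Moments of a function with radial slits\<close>

text \<open>
  Polar coordinates turn circular sectors into rectangles, where the contour can be deformed by
  means of a primitive.
\<close>

lemma norm_integral_strip_inner_le:
  fixes h :: "complex \<Rightarrow> complex"
  assumes hol: "h holomorphic_on {w. A < Im w \<and> Im w < B}"
    and AB: "A < a" "a \<le> b" "b < B" and "\<tau> \<le> T"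
    and K: "\<And>t. \<tau> \<le> t \<Longrightarrow> t \<le> T \<Longrightarrow> norm (h (Complex t a)) \<le> K"
      "\<And>t. \<tau> \<le> t \<Longrightarrow> t \<le> T \<Longrightarrow> norm (h (Complex t b)) \<le> K"
      "\<And>p. a \<le> p \<Longrightarrow> p \<le> b \<Longrightarrow> norm (h (Complex \<tau> p)) \<le> K"
  shows "norm (integral {a..b} (\<lambda>p. h (Complex T p))) \<le> K * (b - a + 2 * (T - \<tau>))"
proof -
  let ?S = "{w. A < Im w \<and> Im w < B}"
  have S: "convex ?S" "open ?S"
    by (auto simp: Collect_conj_eq intro!: convex_Int convex_halfspace_Im_gt convex_halfspace_Im_lt
        open_Int open_halfspace_Im_gt open_halfspace_Im_lt)
  obtain H where "\<And>x. x \<in> ?S \<Longrightarrow> (H has_field_derivative h x) (at x within ?S)"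
    using holomorphic_convex_primitive'[OF S hol] by blast
  then have H: "(H has_field_derivative h x) (at x)" if "A < Im x" "Im x < B" for x
    using that S(2) by (metis (mono_tags, lifting) at_within_open mem_Collect_eq)
  have seg: "norm (H x - H y) \<le> K * norm (x - y)"
    if "\<And>z. z \<in> closed_segment x y \<Longrightarrow> A < Im z \<and> Im z < B \<and> norm (h z) \<le> K" for x y
    using that by (intro field_differentiable_bound[of "closed_segment x y" H h])
      (auto intro: H has_field_derivative_at_within)
  have int: "((\<lambda>p. h (Complex T p)) has_integral (H (Complex T b) / \<i> - H (Complex T a) / \<i>)) {a..b}"
  proof (intro fundamental_theorem_of_calculus AB(2))
    fix p assume p: "p \<in> {a..b}"
    have "Complex T = (\<lambda>p. of_real T + \<i> * of_real p)"
      by (simp add: fun_eq_iff Complex_eq)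
    then have "(Complex T has_vector_derivative \<i>) (at p within {a..b})"
      unfolding has_vector_derivative_def by (auto intro!: derivative_eq_intros simp: scaleR_conv_of_real)
    moreover have "(H has_field_derivative h (Complex T p)) (at (Complex T p))"
      using p AB by (intro H) auto
    ultimately have "((\<lambda>p. H (Complex T p)) has_vector_derivative \<i> * h (Complex T p)) (at p within {a..b})"
      using field_vector_diff_chain_within[of "Complex T" \<i> p "{a..b}" H] by (simp add: o_def has_field_derivative_at_within)
    from has_vector_derivative_divide[OF this, of \<i>]
    show "((\<lambda>p. H (Complex T p) / \<i>) has_vector_derivative h (Complex T p)) (at p within {a..b})"
      by simp
  qed
  have side: "norm (H (Complex T p) - H (Complex \<tau> p)) \<le> K * (T - \<tau>)"
    if p: "A < p" "p < B" "\<And>t. \<tau> \<le> t \<Longrightarrow> t \<le> T \<Longrightarrow> norm (h (Complex t p)) \<le> K" for p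
  proof -
    have "norm (H (Complex T p) - H (Complex \<tau> p)) \<le> K * norm (Complex T p - Complex \<tau> p)"
    proof (rule seg)
      fix z assume "z \<in> closed_segment (Complex T p) (Complex \<tau> p)"
      then have "Im z = p" "\<tau> \<le> Re z" "Re z \<le> T"
        using assms(5) by (auto simp: closed_segment_same_Im closed_segment_eq_real_ivl split: if_splits)
      then show "A < Im z \<and> Im z < B \<and> norm (h z) \<le> K"
        using p by (metis complex.collapse)
    qed
    also have "norm (Complex T p - Complex \<tau> p) = T - \<tau>"
      using assms(5) by (simp add: complex_diff cmod_def)
    finally show ?thesis .
  qed
  have bot: "norm (H (Complex \<tau> b) - H (Complex \<tau> a)) \<le> K * (b - a)"
  proof -
    have "norm (H (Complex \<tau> b) - H (Complex \<tau> a)) \<le> K * norm (Complex \<tau> b - Complex \<tau> a)"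
    proof (rule seg)
      fix z assume "z \<in> closed_segment (Complex \<tau> b) (Complex \<tau> a)"
      then have "Re z = \<tau>" "a \<le> Im z" "Im z \<le> b"
        using AB by (auto simp: closed_segment_same_Re closed_segment_eq_real_ivl split: if_splits)
      then show "A < Im z \<and> Im z < B \<and> norm (h z) \<le> K"
        using K(3)[of "Im z"] AB by (metis complex.collapse le_less_trans less_le_trans)
    qed
    also have "norm (Complex \<tau> b - Complex \<tau> a) = b - a"
      using AB by (simp add: complex_diff cmod_def)
    finally show ?thesis .
  qed
  have "integral {a..b} (\<lambda>p. h (Complex T p)) = (H (Complex T b) - H (Complex T a)) / \<i>"
    using integral_unique[OF int] by (simp only: diff_divide_distrib)
  then have "norm (integral {a..b} (\<lambda>p. h (Complex T p))) = norm (H (Complex T b) - H (Complex T a))"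
    by (simp only: norm_divide norm_ii div_by_1)
  \<comment> \<open>The segment on \<open>Re w = T\<close> is exchanged for the path through
    \<open>Complex \<tau> a\<close> and \<open>Complex \<tau> b\<close>, whose three sides have
    total length \<open>b - a + 2 * (T - \<tau>)\<close>.\<close>
  also have "\<dots> = norm ((H (Complex T b) - H (Complex \<tau> b)) + (H (Complex \<tau> b) - H (Complex \<tau> a))
      - (H (Complex T a) - H (Complex \<tau> a)))"
    by (simp add: algebra_simps)
  also have "\<dots> \<le> norm (H (Complex T b) - H (Complex \<tau> b)) + norm (H (Complex \<tau> b) - H (Complex \<tau> a))
      + norm (H (Complex T a) - H (Complex \<tau> a))"
    by (intro order_trans[OF norm_triangle_ineq4] add_right_mono norm_triangle_ineq)
  also have "\<dots> \<le> K * (T - \<tau>) + K * (b - a) + K * (T - \<tau>)"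
    using AB K by (intro add_mono side bot) auto
  finally show ?thesis by (simp add: algebra_simps)
qed

text \<open>Since \<open>f\<close> may jump across the edges of the strip, the contour is moved in a
  slightly narrower strip. Uniform continuity of \<open>g\<close> carries its bound from the edges
  to the shifted lines, and the two omitted ends of the segment on \<open>Re w = T\<close> are
  short.\<close>

lemma norm_integral_strip_le:
  fixes f g :: "complex \<Rightarrow> complex"
  assumes f: "f holomorphic_on {w. A < Im w \<and> Im w < B}" and g: "g holomorphic_on UNIV"
    and AB: "A < B" and T: "\<tau> \<le> T"
    and M: "\<And>w. A < Im w \<Longrightarrow> Im w < B \<Longrightarrow> \<tau> \<le> Re w \<Longrightarrow> norm (f w) \<le> M"
    and cont: "continuous_on {A..B} (\<lambda>p. f (Complex T p))"
    and S: "\<And>t. \<tau> \<le> t \<Longrightarrow> t \<le> T \<Longrightarrow> norm (g (Complex t A)) \<le> S"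
      "\<And>t. \<tau> \<le> t \<Longrightarrow> t \<le> T \<Longrightarrow> norm (g (Complex t B)) \<le> S"
      "\<And>p. A \<le> p \<Longrightarrow> p \<le> B \<Longrightarrow> norm (g (Complex \<tau> p)) \<le> S"
  shows "norm (integral {A..B} (\<lambda>p. f (Complex T p) * g (Complex T p))) \<le> M * S * (B - A + 2 * (T - \<tau>))"
proof (rule field_le_epsilon)
  fix e :: real assume e: "0 < e"
  let ?h = "\<lambda>w. f w * g w"
  have gc: "continuous_on X g" for X
    using g holomorphic_on_imp_continuous_on holomorphic_on_subset by blast
  have cC: "continuous_on X (\<lambda>p. Complex T p)" for X
    unfolding complex_eq by (intro continuous_intros)
  have ch: "continuous_on {A..B} (\<lambda>p. ?h (Complex T p))"
    by (intro continuous_intros cont continuous_on_compose2[OF gc[of UNIV] cC]) auto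
  have M0: "0 \<le> M"
    using AB by (intro order_trans[OF norm_ge_zero M[of "Complex \<tau> ((A + B) / 2)"]]) auto
  have S0: "0 \<le> S" using S(1)[of T] T norm_ge_zero order_trans by blast
  obtain G where G: "\<And>p. A \<le> p \<Longrightarrow> p \<le> B \<Longrightarrow> norm (?h (Complex T p)) \<le> G"
    using compact_imp_bounded[OF compact_continuous_image[OF ch compact_Icc]]
    by (fastforce simp: bounded_iff)
  have G0: "0 \<le> G" using G[of A] AB norm_ge_zero order_trans by (metis less_imp_le order_refl)
  define c where "c = B - A + 2 * (T - \<tau>)"
  have c0: "0 < c" using AB T by (simp add: c_def)
  define \<epsilon> where "\<epsilon> = e / (2 * c * (M + 1))"
  have e0: "0 < \<epsilon>" using e c0 M0 by (simp add: \<epsilon>_def)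
  have "uniformly_continuous_on (cbox (Complex \<tau> A) (Complex T B)) g"
    by (intro compact_uniformly_continuous gc compact_cbox)
  then obtain \<delta> where \<delta>: "0 < \<delta>" "\<And>x y. x \<in> cbox (Complex \<tau> A) (Complex T B) \<Longrightarrow>
      y \<in> cbox (Complex \<tau> A) (Complex T B) \<Longrightarrow> dist y x < \<delta> \<Longrightarrow> dist (g y) (g x) < \<epsilon>"
    using e0 unfolding uniformly_continuous_on_def by metis
  \<comment> \<open>The three bounds keep the shifted lines within reach of uniform continuity, keep
    the narrower strip nonempty, and limit the two omitted ends to \<open>e / 2\<close> in total.
    The choice of \<open>\<epsilon>\<close> spends the other half of \<open>e\<close>.\<close>
  define \<eta> where "\<eta> = Min {\<delta> / 2, (B - A) / 3, e / (4 * (G + 1))}"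
  have \<eta>: "0 < \<eta>" "\<eta> < \<delta>" "\<eta> \<le> (B - A) / 3" "\<eta> \<le> e / (4 * (G + 1))"
  proof -
    show "0 < \<eta>" using \<delta>(1) AB e G0 by (simp add: \<eta>_def)
    have "\<eta> \<le> \<delta> / 2" unfolding \<eta>_def by (rule Min_le) auto
    then show "\<eta> < \<delta>" using \<delta>(1) by simp
    show "\<eta> \<le> (B - A) / 3" "\<eta> \<le> e / (4 * (G + 1))" unfolding \<eta>_def by (rule Min_le; simp)+
  qed
  let ?a = "A + \<eta>" and ?b = "B - \<eta>"
  have ab: "A < ?a" "?a \<le> ?b" "?b < B" using \<eta> AB by auto
  have near: "norm (g (Complex t p)) \<le> S + \<epsilon>"
    if "\<tau> \<le> t" "t \<le> T" "A \<le> p" "p \<le> B" "q = A \<or> q = B" "\<bar>p - q\<bar> < \<delta>" for t p q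
  proof -
    have "dist (Complex t p) (Complex t q) = \<bar>p - q\<bar>"
      by (simp add: dist_norm complex_diff cmod_def)
    then have "dist (g (Complex t p)) (g (Complex t q)) < \<epsilon>"
      using that AB by (intro \<delta>(2)) (auto simp: in_cbox_complex_iff)
    moreover have "norm (g (Complex t q)) \<le> S" using S(1,2) that by blast
    ultimately show ?thesis
      using norm_triangle_ineq2[of "g (Complex t p)" "g (Complex t q)"] by (simp add: dist_norm)
  qed
  have inner: "norm (integral {?a..?b} (\<lambda>p. ?h (Complex T p))) \<le> M * (S + \<epsilon>) * (?b - ?a + 2 * (T - \<tau>))"
  proof (rule norm_integral_strip_inner_le[OF _ ab T])
    show "?h holomorphic_on {w. A < Im w \<and> Im w < B}"
      by (intro holomorphic_intros f holomorphic_on_subset[OF g]) auto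
    show "norm (?h (Complex t ?a)) \<le> M * (S + \<epsilon>)" if "\<tau> \<le> t" "t \<le> T" for t
      unfolding norm_mult using that ab \<eta> AB M0 by (intro mult_mono M near[of _ _ A]) auto
    show "norm (?h (Complex t ?b)) \<le> M * (S + \<epsilon>)" if "\<tau> \<le> t" "t \<le> T" for t
      unfolding norm_mult using that ab \<eta> AB M0 by (intro mult_mono M near[of _ _ B]) auto
    show "norm (?h (Complex \<tau> p)) \<le> M * (S + \<epsilon>)" if "?a \<le> p" "p \<le> ?b" for p
      unfolding norm_mult using that ab \<eta> AB M0 e0 S(3)[of p] by (intro mult_mono M) auto
  qed
  have intg: "(\<lambda>p. ?h (Complex T p)) integrable_on {x..y}" if "A \<le> x" "y \<le> B" for x y
    using that by (intro integrable_continuous_real continuous_on_subset[OF ch]) auto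
  have tail: "norm (integral {x..y} (\<lambda>p. ?h (Complex T p))) \<le> G * (y - x)" if "A \<le> x" "x \<le> y" "y \<le> B" for x y
    using that G by (intro integral_bound continuous_on_subset[OF ch]) auto
  have split: "integral {A..B} (\<lambda>p. ?h (Complex T p)) = integral {A..?a} (\<lambda>p. ?h (Complex T p))
      + integral {?a..?b} (\<lambda>p. ?h (Complex T p)) + integral {?b..B} (\<lambda>p. ?h (Complex T p))"
    (is "_ = ?I1 + ?I2 + ?I3")
  proof -
    let ?I23 = "integral {?a..B} (\<lambda>p. ?h (Complex T p))"
    have "?I1 + ?I23 = integral {A..B} (\<lambda>p. ?h (Complex T p))"
      using ab by (intro Henstock_Kurzweil_Integration.integral_combine intg) auto
    moreover have "?I2 + ?I3 = ?I23"
      using ab by (intro Henstock_Kurzweil_Integration.integral_combine intg) auto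
    moreover have "x = a + b + c" if "a + d = x" "b + c = d" for x a b c d :: complex
      using that by auto
    ultimately show ?thesis by blast
  qed
  have "norm (integral {A..B} (\<lambda>p. ?h (Complex T p))) \<le> norm (integral {A..?a} (\<lambda>p. ?h (Complex T p)))
      + norm (integral {?a..?b} (\<lambda>p. ?h (Complex T p))) + norm (integral {?b..B} (\<lambda>p. ?h (Complex T p)))"
    unfolding split by (intro order_trans[OF norm_triangle_ineq] add_right_mono norm_triangle_ineq)
  also have "\<dots> \<le> G * (?a - A) + M * (S + \<epsilon>) * (?b - ?a + 2 * (T - \<tau>)) + G * (B - ?b)"
    by (rule add_mono[OF add_mono[OF tail inner] tail]) (use ab in linarith)+
  also have "\<dots> \<le> M * (S + \<epsilon>) * c + 2 * (G * \<eta>)"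
  proof -
    have "M * (S + \<epsilon>) * (?b - ?a + 2 * (T - \<tau>)) \<le> M * (S + \<epsilon>) * c"
      using M0 S0 e0 \<eta>(1) unfolding c_def by (intro mult_left_mono mult_nonneg_nonneg) linarith+
    then show ?thesis by simp
  qed
  also have "\<dots> = M * S * c + M * \<epsilon> * c + 2 * (G * \<eta>)" by (simp add: algebra_simps)
  also have "M * \<epsilon> * c \<le> e / 2"
  proof -
    have "M * \<epsilon> * c = (M / (M + 1)) * (e / 2)"
      using c0 M0 by (simp add: \<epsilon>_def)
    also have "\<dots> \<le> 1 * (e / 2)"
      using M0 e by (intro mult_right_mono) auto
    finally show ?thesis by simp
  qed
  also have "2 * (G * \<eta>) \<le> e / 2"
  proof -
    have "G * \<eta> \<le> G * (e / (4 * (G + 1)))" using \<eta> G0 by (intro mult_left_mono) auto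
    also have "\<dots> = (G / (G + 1)) * (e / 4)" by simp
    also have "\<dots> \<le> 1 * (e / 4)" using G0 e by (intro mult_right_mono) auto
    finally show ?thesis by simp
  qed
  finally show "norm (integral {A..B} (\<lambda>p. ?h (Complex T p))) \<le> M * S * (B - A + 2 * (T - \<tau>)) + e"
    by (simp add: c_def)
qed

text \<open>Induction on the slits, cutting the strip at the largest one. A slit has two banks, so
  it adds \<open>2 * (T - \<tau>)\<close> to the length of the contour.\<close>

lemma norm_integral_slit_strip_le:
  fixes f g :: "complex \<Rightarrow> complex"
  assumes "finite \<Theta>" and "\<Theta> \<subseteq> {A<..<B}" and "A < B"
    and "f holomorphic_on {w. A < Im w \<and> Im w < B \<and> Im w \<notin> \<Theta>}"
    and g: "g holomorphic_on UNIV" and T: "\<tau> \<le> T"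
    and "\<And>w. A < Im w \<Longrightarrow> Im w < B \<Longrightarrow> Im w \<notin> \<Theta> \<Longrightarrow> \<tau> \<le> Re w \<Longrightarrow> norm (f w) \<le> M"
    and "continuous_on {A..B} (\<lambda>p. f (Complex T p))"
    and "\<And>t p. \<tau> \<le> t \<Longrightarrow> t \<le> T \<Longrightarrow> p \<in> insert A (insert B \<Theta>) \<Longrightarrow> norm (g (Complex t p)) \<le> S"
    and "\<And>p. A \<le> p \<Longrightarrow> p \<le> B \<Longrightarrow> norm (g (Complex \<tau> p)) \<le> S"
  shows "norm (integral {A..B} (\<lambda>p. f (Complex T p) * g (Complex T p)))
    \<le> M * S * (B - A + 2 * real (card \<Theta> + 1) * (T - \<tau>))"
  using assms(1-4,7-)
proof (induction \<Theta> arbitrary: B rule: finite_linorder_max_induct)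
  case empty
  then show ?case
    using norm_integral_strip_le[of f A B g \<tau> T M S] g T by simp
next
  case (insert b \<Theta>)
  have b: "A < b" "b < B" using insert.prems by auto
  have 1: "norm (integral {A..b} (\<lambda>p. f (Complex T p) * g (Complex T p)))
      \<le> M * S * (b - A + 2 * real (card \<Theta> + 1) * (T - \<tau>))"
  proof (rule insert.IH[of b])
    show "\<Theta> \<subseteq> {A<..<b}" using insert by auto
    show "f holomorphic_on {w. A < Im w \<and> Im w < b \<and> Im w \<notin> \<Theta>}"
      by (rule holomorphic_on_subset[OF insert.prems(3)]) (use b in auto)
    show "continuous_on {A..b} (\<lambda>p. f (Complex T p))"
      by (rule continuous_on_subset[OF insert.prems(5)]) (use b in auto)
  qed (use b insert.prems in auto)
  have 2: "norm (integral {b..B} (\<lambda>p. f (Complex T p) * g (Complex T p)))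
      \<le> M * S * (B - b + 2 * (T - \<tau>))"
  proof (rule norm_integral_strip_le[OF _ g b(2) T])
    show "f holomorphic_on {w. b < Im w \<and> Im w < B}"
      by (rule holomorphic_on_subset[OF insert.prems(3)]) (use b insert.hyps in auto)
    show "continuous_on {b..B} (\<lambda>p. f (Complex T p))"
      by (rule continuous_on_subset[OF insert.prems(5)]) (use b in auto)
    show "norm (f w) \<le> M" if "b < Im w" "Im w < B" "\<tau> \<le> Re w" for w
      using that b insert.hyps by (intro insert.prems(4)) auto
  qed (use b insert.prems in auto)
  have cC: "continuous_on X (\<lambda>p. Complex T p)" for X
    unfolding complex_eq by (intro continuous_intros)
  have gc: "continuous_on UNIV g" using g holomorphic_on_imp_continuous_on by blast
  have "integral {A..B} (\<lambda>p. f (Complex T p) * g (Complex T p))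
      = integral {A..b} (\<lambda>p. f (Complex T p) * g (Complex T p)) + integral {b..B} (\<lambda>p. f (Complex T p) * g (Complex T p))"
    using b by (intro Henstock_Kurzweil_Integration.integral_combine[symmetric] integrable_continuous_real
        continuous_intros insert.prems(5) continuous_on_compose2[OF gc cC]) auto
  also have "norm \<dots> \<le> M * S * (b - A + 2 * real (card \<Theta> + 1) * (T - \<tau>)) + M * S * (B - b + 2 * (T - \<tau>))"
    by (intro order_trans[OF norm_triangle_ineq] add_mono 1 2)
  also have "\<dots> = M * S * (B - A + 2 * real (card (insert b \<Theta>) + 1) * (T - \<tau>))"
  proof -
    have "b \<notin> \<Theta>" using insert.hyps by auto
    then have "real (card (insert b \<Theta>) + 1) = real (card \<Theta> + 1) + 1"
      using insert.hyps by simp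
    then show ?thesis by (simp only: algebra_simps)
  qed
  finally show ?case .
qed

text \<open>
  Of the inner disc only the boundary circle is needed: the spines inside it do not affect the moments.
\<close>

definition hedgehog :: "real \<Rightarrow> real \<Rightarrow> real set \<Rightarrow> complex set" where
  "hedgehog \<tau> T \<Theta> = {of_real (exp t) * cis \<theta> | t \<theta>. \<tau> \<le> t \<and> t \<le> T \<and> (\<tau> < t \<longrightarrow> \<theta> \<in> \<Theta>)}"

lemma exp_Complex: "exp (Complex t p) = of_real (exp t) * cis p"
  using exp_eq_polar[of "Complex t p"] by (simp only: complex.sel)

text \<open>The expression can be real and nonpositive only if \<open>exp w\<close> lies on the ray
  from 0 through \<open>b\<close>. As \<open>Arg2pi\<close> takes values in
  \<open>[0, 2 pi)\<close>, the only possible height of such a \<open>w\<close> in the strip is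
  \<open>Arg2pi b - 2 * pi\<close>.\<close>

lemma one_minus_mult_exp_notin_slit:
  fixes b w :: complex
  assumes "b \<noteq> 0" and "- 2 * pi < Im w" "Im w < 0" and "Im w \<noteq> Arg2pi b - 2 * pi"
  shows "1 - b * exp (- w) \<notin> \<real>\<^sub>\<le>\<^sub>0"
proof
  assume "1 - b * exp (- w) \<in> \<real>\<^sub>\<le>\<^sub>0"
  then obtain y where y: "1 - b * exp (- w) = of_real y" "y \<le> 0"
    by (auto simp: nonpos_Reals_def)
  then have "b * exp (- w) = of_real (1 - y)" by (simp add: algebra_simps)
  then have "b = of_real (1 - y) * exp w"
    by (metis (no_types, lifting) exp_minus_inverse mult.assoc mult.commute mult.right_neutral)
  also have "exp w = of_real (exp (Re w)) * exp (\<i> * of_real (Im w + 2 * pi))"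
  proof -
    have "exp (\<i> * of_real (Im w + 2 * pi)) = cis (Im w)"
      unfolding cis_conv_exp[symmetric] by (simp flip: cis_mult)
    then show ?thesis using exp_eq_polar[of w] by (simp only:)
  qed
  finally have "of_real ((1 - y) * exp (Re w)) * exp (\<i> * of_real (Im w + 2 * pi)) = b"
    by (simp add: mult.assoc)
  from Arg2pi_unique[OF this] show False using assms y by auto
qed

text \<open>
  The direction 0 is always in \<open>\<Theta>\<close> because the circle is cut open there.
\<close>

lemma norm_moments_le_hedgehog:
  fixes \<beta> :: "'j \<Rightarrow> complex"
  assumes J: "finite J" and \<beta>: "\<And>j. j \<in> J \<Longrightarrow> \<beta> j \<noteq> 0" "\<And>j. j \<in> J \<Longrightarrow> norm (\<beta> j) < exp T"
    and T: "\<tau> \<le> T"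
    and \<Theta>: "finite \<Theta>" "0 \<in> \<Theta>" "\<And>j. j \<in> J \<Longrightarrow> Arg2pi (\<beta> j) - 2 * pi \<in> \<Theta>"
  defines "F \<equiv> \<lambda>x. \<Prod>j\<in>J. csqrt (1 - \<beta> j * x)"
  obtains B where "\<And>M c S. (\<And>z. z \<in> hedgehog \<tau> T \<Theta> \<Longrightarrow> norm (\<Sum>k\<le>M. c k * z ^ k) \<le> S) \<Longrightarrow>
    norm (\<Sum>k\<le>M. c k * fps_nth (fps_expansion F 0) k) \<le> B * S"
proof -
  \<comment> \<open>The coordinate is \<open>w\<close> with \<open>z = exp w\<close>, and the
    variable of the power series is \<open>1 / z = exp (- w)\<close>.\<close>
  define f where "f = (\<lambda>w. F (exp (- w)))"
  \<comment> \<open>Slits lie strictly inside the strip; the heights \<open>0\<close> and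
    \<open>- 2 * pi\<close> are its edges, both over direction 0.\<close>
  define \<Theta>' where "\<Theta>' = \<Theta> \<inter> {- 2 * pi<..<0}"
  define N where "N = (\<Prod>j\<in>J. sqrt (1 + norm (\<beta> j) * exp (- \<tau>)))"
  define B where "B = N * (2 * pi + 2 * real (card \<Theta>' + 1) * (T - \<tau>)) / (2 * pi)"
  have small: "1 - \<beta> j * x \<notin> \<real>\<^sub>\<le>\<^sub>0" if "j \<in> J" "norm x \<le> exp (- T)" for j x
  proof -
    have "norm (\<beta> j * x) \<le> norm (\<beta> j) * exp (- T)"
      using that by (simp add: norm_mult mult_left_mono)
    also have "\<dots> < exp T * exp (- T)" using \<beta>(2)[OF that(1)] by simp
    finally have "norm (\<beta> j * x) < 1" by (simp flip: exp_add)
    then have "Re (\<beta> j * x) < 1" using complex_Re_le_cmod[of "\<beta> j * x"] by linarith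
    then show ?thesis by (auto simp: complex_nonpos_Reals_iff)
  qed
  have holF: "F holomorphic_on cball 0 (exp (- T))"
    unfolding F_def by (intro holomorphic_intros small) auto
  have f_hol: "f holomorphic_on {w. - 2 * pi < Im w \<and> Im w < 0 \<and> Im w \<notin> \<Theta>'}"
    unfolding f_def F_def
    by (intro holomorphic_intros one_minus_mult_exp_notin_slit \<beta>) (use \<Theta> in \<open>auto simp: \<Theta>'_def\<close>)
  have f_bd: "norm (f w) \<le> N" if "\<tau> \<le> Re w" for w
  proof -
    have "norm (csqrt (1 - \<beta> j * exp (- w))) \<le> sqrt (1 + norm (\<beta> j) * exp (- \<tau>))" for j
    proof -
      have "norm (1 - \<beta> j * exp (- w)) \<le> 1 + norm (\<beta> j * exp (- w))"
        using norm_triangle_ineq4[of 1 "\<beta> j * exp (- w)"] by simp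
      also have "\<dots> \<le> 1 + norm (\<beta> j) * exp (- \<tau>)"
        using that by (simp add: norm_mult mult_left_mono)
      finally show ?thesis by simp
    qed
    then show ?thesis unfolding f_def F_def N_def prod_norm[symmetric] by (intro prod_mono) auto
  qed
  have f_cont: "continuous_on {- 2 * pi..0} (\<lambda>p. f (Complex T p))"
  proof -
    have "continuous_on {- 2 * pi..0} (\<lambda>p. exp (- Complex T p))"
      unfolding Complex_eq by (intro continuous_intros)
    then show ?thesis
      unfolding f_def
      by (rule continuous_on_compose2[OF holomorphic_on_imp_continuous_on[OF holF]]) auto
  qed
  show thesis
  proof (rule that[of B])
    fix M :: nat and c S
    assume S: "\<And>z. z \<in> hedgehog \<tau> T \<Theta> \<Longrightarrow> norm (\<Sum>k\<le>M. c k * z ^ k) \<le> S"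
    define g where "g = (\<lambda>w. \<Sum>k\<le>M. c k * exp w ^ k)"
    let ?L = "\<Sum>k\<le>M. c k * fps_nth (fps_expansion F 0) k"
    have "norm (integral {- 2 * pi..0} (\<lambda>p. f (Complex T p) * g (Complex T p)))
        \<le> N * S * (0 - (- 2 * pi) + 2 * real (card \<Theta>' + 1) * (T - \<tau>))"
    proof (rule norm_integral_slit_strip_le[OF _ _ _ f_hol _ T _ f_cont])
      show "g holomorphic_on UNIV" unfolding g_def by (intro holomorphic_intros)
      fix t p assume t: "\<tau> \<le> t" "t \<le> T" and p: "p \<in> insert (- 2 * pi) (insert 0 \<Theta>')"
      have "exp (Complex t p) \<in> hedgehog \<tau> T \<Theta>"
      proof (cases "p = - 2 * pi")
        case True
        then have "exp (Complex t p) = of_real (exp t) * cis 0"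
          unfolding exp_Complex by (simp add: complex_eq_iff)
        then show ?thesis using t \<Theta> unfolding hedgehog_def by blast
      next
        case False
        then have "p \<in> \<Theta>" using p \<Theta> by (auto simp: \<Theta>'_def)
        then show ?thesis using t unfolding hedgehog_def exp_Complex by blast
      qed
      then show "norm (g (Complex t p)) \<le> S" unfolding g_def by (rule S)
    next
      fix p :: real
      have "exp (Complex \<tau> p) \<in> hedgehog \<tau> T \<Theta>"
        using T unfolding hedgehog_def exp_Complex by blast
      then show "norm (g (Complex \<tau> p)) \<le> S" unfolding g_def by (rule S)
    qed (use f_bd \<Theta> in \<open>auto simp: \<Theta>'_def\<close>)
    \<comment> \<open>Cauchy's formula on the circle of radius \<open>exp (- T)\<close>: writing its
      points as \<open>exp (- w)\<close> with \<open>w = Complex T (- t)\<close> moves the integral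
      to the line \<open>Re w = T\<close>, with the orientation reversed.\<close>
    moreover have "((\<lambda>p. f (Complex T p) * g (Complex T p)) has_integral (2 * pi * ?L)) {- 2 * pi..0}"
    proof -
      define r where "r = exp (- T)"
      have r: "0 < r" by (simp add: r_def)
      have "((\<lambda>u. F u / u ^ Suc k) has_contour_integral (2 * pi * \<i>) * fps_nth (fps_expansion F 0) k)
          (circlepath 0 r)" for k
      proof -
        have "continuous_on (cball 0 r) F" "F holomorphic_on ball 0 r" "0 \<in> ball 0 r"
          using holF r holomorphic_on_subset[OF holF ball_subset_cball]
          by (simp_all add: r_def holomorphic_on_imp_continuous_on)
        from Cauchy_has_contour_integral_higher_derivative_circlepath[OF this, of k]
        show ?thesis by (simp add: fps_expansion_def)
      qed
      then have "((\<lambda>u. \<Sum>k\<le>M. c k * (F u / u ^ Suc k)) has_contour_integral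
          (\<Sum>k\<le>M. c k * ((2 * pi * \<i>) * fps_nth (fps_expansion F 0) k))) (circlepath 0 r)"
        by (intro has_contour_integral_sum has_contour_integral_lmul) auto
      then have "((\<lambda>t. (\<Sum>k\<le>M. c k * (F (0 + r * cis t) / (0 + r * cis t) ^ Suc k)) * r * \<i> * cis t) has_integral
          (\<Sum>k\<le>M. c k * ((2 * pi * \<i>) * fps_nth (fps_expansion F 0) k))) {0..2 * pi}"
        unfolding circlepath_def by (subst (asm) has_contour_integral_part_circlepath_iff) auto
      moreover have "(\<Sum>k\<le>M. c k * (F (0 + r * cis t) / (0 + r * cis t) ^ Suc k)) * r * \<i> * cis t
          = \<i> * (f (Complex T (- t)) * g (Complex T (- t)))" for t
      proof -
        have e: "exp (Complex T (- t)) = inverse (r * cis t)"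
          unfolding exp_Complex r_def by (simp add: exp_minus cis_inverse)
        then have "exp (- Complex T (- t)) = r * cis t" by (simp add: exp_minus)
        then have f: "f (Complex T (- t)) = F (r * cis t)" by (simp add: f_def)
        have "g (Complex T (- t)) = (\<Sum>k\<le>M. c k / (r * cis t) ^ k)"
          unfolding g_def e by (simp only: divide_inverse power_inverse)
        moreover have "c k * (F (r * cis t) / (r * cis t) ^ Suc k) * r * \<i> * cis t
            = \<i> * (F (r * cis t) * (c k / (r * cis t) ^ k))" for k
          using r by (simp add: field_simps)
        ultimately show ?thesis
          unfolding f by (simp add: sum_distrib_left sum_distrib_right)
      qed
      moreover have "(\<Sum>k\<le>M. c k * ((2 * pi * \<i>) * fps_nth (fps_expansion F 0) k)) = \<i> * (2 * pi * ?L)"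
        by (simp add: sum_distrib_left mult_ac)
      ultimately have "((\<lambda>t. \<i> * (f (Complex T (- t)) * g (Complex T (- t)))) has_integral
          \<i> * (2 * pi * ?L)) {0..2 * pi}" by (simp only:)
      from has_integral_mult_right[OF this, of "- \<i>"]
      have "((\<lambda>t. f (Complex T (- t)) * g (Complex T (- t))) has_integral (2 * pi * ?L)) {0..2 * pi}"
        by (simp add: mult.assoc[symmetric])
      from has_integral_reflect_lemma_real[OF this] show ?thesis by simp
    qed
    then have "integral {- 2 * pi..0} (\<lambda>p. f (Complex T p) * g (Complex T p)) = 2 * pi * ?L"
      by (rule integral_unique)
    ultimately have "2 * pi * norm ?L \<le> N * S * (2 * pi + 2 * real (card \<Theta>' + 1) * (T - \<tau>))"
      by (simp add: norm_mult)
    then show "norm ?L \<le> B * S" by (simp add: B_def field_simps)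
  qed
qed

section \<open>Vanishing of integral Hankel determinants\<close>

text \<open>The determinants are integers, bounded by a geometric factor times
  \<open>exp (N * C - \<delta> * N^2)\<close>. The quadratic term dominates, so from some
  \<open>N\<close> on their modulus is less than 1.\<close>

lemma det_hankel_mat_eventually_zero:
  fixes \<beta> :: "'j \<Rightarrow> complex"
  assumes J: "finite J" and \<beta>: "\<And>j. j \<in> J \<Longrightarrow> \<beta> j \<noteq> 0" "\<And>j. j \<in> J \<Longrightarrow> norm (\<beta> j) < exp T"
    and T: "0 \<le> T" "T \<le> 198/1000 / (real (card J) + 1)"
  defines "F \<equiv> \<lambda>x. \<Prod>j\<in>J. csqrt (1 - \<beta> j * x)"
  assumes int: "\<And>k. fps_nth (fps_expansion F 0) k \<in> \<int>"
  obtains N0 where "\<And>N. N0 \<le> N \<Longrightarrow> det (hankel_mat (fps_nth (fps_expansion F 0)) N) = 0"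
proof -
  \<comment> \<open>The additional 1 accounts for direction 0, where the circle is cut.\<close>
  define n where "n = real (card J) + 1"
  have n: "0 < n" by (simp add: n_def)
  define \<Theta> where "\<Theta> = insert 0 ((\<lambda>j. Arg2pi (\<beta> j) - 2 * pi) ` J)"
  have "card ((\<lambda>j. Arg2pi (\<beta> j) - 2 * pi) ` J) \<le> card J" using J by (rule card_image_le)
  then have \<Theta>: "finite \<Theta>" "real (card \<Theta>) \<le> n" using J
    by (auto simp: \<Theta>_def n_def card_insert_if)
  define \<tau> where "\<tau> = T - 17/20 / n"
  have \<tau>: "\<tau> \<le> T" using n by (simp add: \<tau>_def)
  let ?a = "fps_nth (fps_expansion F 0)"
  obtain B where B: "\<And>M c S. (\<And>z. z \<in> hedgehog \<tau> T \<Theta> \<Longrightarrow> norm (\<Sum>k\<le>M. c k * z ^ k) \<le> S) \<Longrightarrow>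
      norm (\<Sum>k\<le>M. c k * ?a k) \<le> B * S"
  proof (rule norm_moments_le_hedgehog[OF J, of \<beta> T \<tau> \<Theta>, folded F_def])
    show "\<beta> j \<noteq> 0" "norm (\<beta> j) < exp T" "Arg2pi (\<beta> j) - 2 * pi \<in> \<Theta>" if "j \<in> J" for j
      using \<beta> that by (auto simp: \<Theta>_def)
    show "0 \<in> \<Theta>" by (simp add: \<Theta>_def)
    show "\<tau> \<le> T" "finite \<Theta>" by fact+
  qed (rule that, blast)
  \<comment> \<open>Positivity makes \<open>ln B'\<close> meaningful. The moment bound survives the
    enlargement because \<open>S\<close> is nonnegative, the hedgehog being nonempty.\<close>
  define B' where "B' = max B 1"
  have "of_real (exp T) * cis 0 \<in> hedgehog \<tau> T \<Theta>"
    unfolding hedgehog_def \<Theta>_def using \<tau> by blast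
  then have B': "norm (\<Sum>k\<le>M. c k * ?a k) \<le> B' * S"
    if S: "\<And>z. z \<in> hedgehog \<tau> T \<Theta> \<Longrightarrow> norm (\<Sum>k\<le>M. c k * z ^ k) \<le> S" for M c S
  proof -
    have "0 \<le> S" using S[OF \<open>_ \<in> hedgehog \<tau> T \<Theta>\<close>] norm_ge_zero order_trans by blast
    then have "B * S \<le> B' * S" by (intro mult_right_mono) (auto simp: B'_def)
    then show ?thesis using B[OF S] by linarith
  qed
  define C where "C = 17/20 / n - ln (1 - exp (- (1/200 / n)))"
  define \<delta> where "\<delta> = 12/1000 / n"
  have \<delta>: "0 < \<delta>" using n by (simp add: \<delta>_def)
  have V: "(\<Prod>i<N. \<Prod>j\<in>{..<N} - {i}. norm (z i - z j)) \<le> exp (real N * C - \<delta> * (real N)\<^sup>2)"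
    if z: "\<And>i. i < N \<Longrightarrow> z i \<in> hedgehog \<tau> T \<Theta>" for z :: "nat \<Rightarrow> complex" and N
  proof -
    have "\<forall>i. \<exists>t \<theta>. i < N \<longrightarrow> z i = of_real (exp t) * cis \<theta> \<and> \<tau> \<le> t \<and> t \<le> T \<and> (\<tau> < t \<longrightarrow> \<theta> \<in> \<Theta>)"
      using z unfolding hedgehog_def by blast
    then obtain t \<theta> where t: "\<And>i. i < N \<Longrightarrow> z i = of_real (exp (t i)) * cis (\<theta> i)"
      "\<And>i. i < N \<Longrightarrow> \<tau> \<le> t i" "\<And>i. i < N \<Longrightarrow> t i \<le> T" "\<And>i. i < N \<Longrightarrow> \<tau> < t i \<Longrightarrow> \<theta> i \<in> \<Theta>"
      by metis
    define x where "x = (\<lambda>i. (T - t i) * n)"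
    have tx: "T - x i / n = t i" for i using n by (simp add: x_def)
    have x: "0 \<le> x i" "x i \<le> 17/20" "x i < 17/20 \<Longrightarrow> \<theta> i \<in> \<Theta>" if "i < N" for i
      proof -
      have \<tau>n: "(T - \<tau>) * n = 17/20" using n by (simp add: \<tau>_def)
      show "0 \<le> x i" using t(3)[OF that] n by (simp add: x_def)
      show "x i \<le> 17/20"
        using t(2)[OF that] n unfolding x_def \<tau>n[symmetric] by (intro mult_right_mono) auto
      show "\<theta> i \<in> \<Theta>" if "x i < 17/20"
        using t(4)[OF \<open>i < N\<close>] that n unfolding x_def \<tau>n[symmetric] by simp
    qed
    have "(\<Prod>i<N. \<Prod>j\<in>{..<N} - {i}. norm (z i - z j)) = (\<Prod>i<N. \<Prod>j\<in>{..<N} - {i}.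
        norm (of_real (exp (T - x i / n)) * cis (\<theta> i) - of_real (exp (T - x j / n)) * cis (\<theta> j)))"
      unfolding tx by (intro prod.cong refl) (simp add: t(1))
    also have "\<dots> \<le> exp (real (card {..<N}) * (17/20 / n - ln (1 - exp (- (1/200 / n))))
        - 12/1000 / n * (real (card {..<N}))\<^sup>2)"
      using x T \<Theta> n by (intro prod_hedgehog_dist_le[of _ \<Theta>]) (auto simp: n_def)
    also have "\<dots> = exp (real N * C - \<delta> * (real N)\<^sup>2)" by (simp add: C_def \<delta>_def)
    finally show ?thesis .
  qed
  obtain N0 :: nat where N0: "(ln B' + C) / \<delta> < real N0" using reals_Archimedean2 by blast
  show thesis
  proof (rule that[of "Suc N0"])
    fix N assume N: "Suc N0 \<le> N"
    have "norm (det (hankel_mat ?a N)) \<le> B' ^ N * exp (real N * C - \<delta> * (real N)\<^sup>2)"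
      by (rule norm_det_hankel_mat_le[OF B' V])
    also have "B' ^ N = exp (real N * ln B')" by (simp add: B'_def exp_of_nat_mult)
    also have "\<dots> * exp (real N * C - \<delta> * (real N)\<^sup>2) = exp (real N * (ln B' + C - \<delta> * real N))"
      by (simp add: power2_eq_square algebra_simps flip: exp_add)
    also have "\<dots> < 1"
    proof -
      have "ln B' + C < \<delta> * real N0" using N0 \<delta> by (simp add: field_simps)
      also have "\<dots> \<le> \<delta> * real N" using N \<delta> by (intro mult_left_mono) auto
      finally show ?thesis using N by (simp add: mult_less_0_iff)
    qed
    finally have "norm (det (hankel_mat ?a N)) < 1" .
    moreover have "det (hankel_mat ?a N) \<in> \<int>"
      unfolding hankel_mat_def det_mat by (intro Ints_sum Ints_mult Ints_prod) (auto intro: int)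
    then obtain m where "det (hankel_mat ?a N) = of_int m" by (elim Ints_cases)
    ultimately show "det (hankel_mat ?a N) = 0" by simp
  qed
qed

section \<open>Integral square roots and multiplicities\<close>

text \<open>
  Coefficients of \<open>g\<close> with \<open>g (X\<^sup>2) = p X * p (- X)\<close>: the roots are squared.
\<close>

definition graeffe :: "(nat \<Rightarrow> int) \<Rightarrow> nat \<Rightarrow> int" where
  "graeffe p k = (\<Sum>i\<le>2 * k. (-1) ^ i * p i * p (2 * k - i))"

lemma graeffe_reflect:
  fixes p q :: "nat \<Rightarrow> int"
  shows "(\<Sum>i\<le>2 * k. (-1) ^ i * p i * q (2 * k - i)) = (\<Sum>i\<le>2 * k. (-1) ^ i * q i * p (2 * k - i))"
proof (rule sum.reindex_bij_witness[of _ "\<lambda>i. 2 * k - i" "\<lambda>i. 2 * k - i"])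
  fix i assume "i \<in> {..2 * k}"
  then have "even (2 * k - i) \<longleftrightarrow> even i" by auto
  then have "(-1 :: int) ^ (2 * k - i) = (-1) ^ i" by (simp add: uminus_power_if)
  with \<open>i \<in> {..2 * k}\<close> show "(-1) ^ (2 * k - i) * q (2 * k - i) * p (2 * k - (2 * k - i))
      = (-1) ^ i * p i * q (2 * k - i)"
    by simp
qed auto

text \<open>The terms \<open>i\<close> and \<open>2 * k - i\<close> are equal, and the middle one
  is, up to sign, the square of \<open>p k\<close>, which has the parity of
  \<open>p k\<close>.\<close>

lemma even_graeffe_diff: "even (graeffe p k - p k)"
proof -
  let ?t = "\<lambda>i. (-1) ^ i * p i * p (2 * k - i)"
  have "graeffe p k = sum ?t {..<k} + ?t k + sum ?t {k<..2 * k}"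
  proof -
    have "{..2 * k} = {..<k} \<union> {k} \<union> {k<..2 * k}" by auto
    moreover have "{..<k} \<inter> {k<..2 * k} = {}" by auto
    ultimately show ?thesis
      unfolding graeffe_def by (simp add: sum.union_disjoint)
  qed
  also have "sum ?t {k<..2 * k} = sum ?t {..<k}"
  proof (rule sum.reindex_bij_witness[of _ "\<lambda>i. 2 * k - i" "\<lambda>i. 2 * k - i"])
    fix i assume i: "i \<in> {k<..2 * k}"
    then have "even (2 * k - i) \<longleftrightarrow> even i" by auto
    then have "(-1 :: int) ^ (2 * k - i) = (-1) ^ i" by (simp add: uminus_power_if)
    with i show "?t (2 * k - i) = ?t i" by simp
  qed auto
  also have "?t k = (-1) ^ k * (p k * p k)" by simp
  finally show ?thesis by (auto simp: uminus_power_if)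
qed

text \<open>For \<open>p = q + 2 h\<close> the two cross terms agree by
  \<open>graeffe_reflect\<close>, so together they contribute a multiple of 4. Applied to
  \<open>graeffe p\<close> and \<open>p\<close>, this gives the congruence between the polynomials
  of the fourth powers and of the squares.\<close>

lemma graeffe_cong_mod_4:
  assumes "\<And>k. even (p k - q k)"
  shows "4 dvd graeffe p k - graeffe q k"
proof -
  define h where "h = (\<lambda>i. (p i - q i) div 2)"
  have p: "p i = q i + 2 * h i" for i
    using assms[of i] by (simp add: h_def)
  let ?s = "\<lambda>f g. \<Sum>i\<le>2 * k. (-1) ^ i * f i * g (2 * k - i)"
  have "graeffe p k = ?s q q + 2 * ?s q h + 2 * ?s h q + 4 * ?s h h"
    unfolding graeffe_def p by (simp add: sum.distrib sum_distrib_left algebra_simps)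
  also have "?s h q = ?s q h" by (rule graeffe_reflect)
  finally have "graeffe p k - graeffe q k = 4 * (?s q h + ?s h h)"
    by (simp add: graeffe_def)
  then show ?thesis by simp
qed

text \<open>Graeffe's identity: multiplying by the substitution of \<open>- X\<close> turns each
  factor into \<open>1 - a^2 X^2\<close>, and the coefficient is read off at index
  \<open>2 * k\<close>.\<close>

lemma prod_fps_squares_nth:
  fixes f :: "'a \<Rightarrow> complex"
  assumes "\<And>k. fps_nth (\<Prod>x\<in>X. 1 - fps_const (f x) * fps_X) k = of_int (p k)"
  shows "fps_nth (\<Prod>x\<in>X. 1 - fps_const ((f x)\<^sup>2) * fps_X) k = of_int (graeffe p k)"
proof -
  let ?P = "\<Prod>x\<in>X. 1 - fps_const (f x) * fps_X" and ?m = "fps_const (- 1) * fps_X :: complex fps"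
  have "?P oo ?m = (\<Prod>x\<in>X. 1 + fps_const (f x) * fps_X)"
    by (subst fps_compose_prod_distrib)
      (auto simp: fps_compose_sub_distrib fps_compose_mult_distrib mult.assoc[symmetric] intro!: prod.cong)
  then have "?P * (?P oo ?m) = (\<Prod>x\<in>X. (1 - fps_const (f x) * fps_X) * (1 + fps_const (f x) * fps_X))"
    by (simp add: prod.distrib)
  also have "\<dots> = (\<Prod>x\<in>X. (1 - fps_const ((f x)\<^sup>2) * fps_X) oo fps_X\<^sup>2)"
    by (intro prod.cong refl)
      (auto simp: fps_compose_sub_distrib fps_compose_mult_distrib power2_eq_square algebra_simps
        simp flip: fps_const_mult)
  also have "\<dots> = (\<Prod>x\<in>X. 1 - fps_const ((f x)\<^sup>2) * fps_X) oo fps_X ^ 2"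
    by (subst fps_compose_prod_distrib) auto
  finally have eq: "?P * (?P oo ?m) = (\<Prod>x\<in>X. 1 - fps_const ((f x)\<^sup>2) * fps_X) oo fps_X ^ 2" .
  have "fps_nth (\<Prod>x\<in>X. 1 - fps_const ((f x)\<^sup>2) * fps_X) k = fps_nth ((?P oo ?m) * ?P) (2 * k)"
    using arg_cong[OF eq, of "\<lambda>g. fps_nth g (2 * k)"] by (simp add: fps_nth_compose_X_power mult.commute)
  also have "\<dots> = (\<Sum>i\<le>2 * k. (-1) ^ i * of_int (p i) * of_int (p (2 * k - i)))"
    unfolding fps_mult_nth fps_nth_compose_linear assms by (simp add: atLeast0AtMost)
  also have "\<dots> = of_int (graeffe p k)" by (simp add: graeffe_def)
  finally show ?thesis .
qed

text \<open>With \<open>S = U + 2 T\<close> and \<open>V = U + 4 W\<close> the equation becomes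
  \<open>U * T + T * T = U * W\<close>. As the constant coefficients of \<open>U\<close> and
  \<open>T\<close> are 1 and 0, it determines each coefficient of \<open>T\<close> from the earlier
  ones without division.\<close>

lemma fps_sqrt_nth_Ints:
  fixes S U V :: "complex fps"
  assumes S: "S * S = U * V" "fps_nth S 0 = 1" and U: "fps_nth U 0 = 1" "\<And>k. fps_nth U k \<in> \<int>"
    and V: "\<And>k. (fps_nth V k - fps_nth U k) / 4 \<in> \<int>"
  shows "fps_nth S k \<in> \<int>"
proof -
  define T where "T = fps_const (1/2) * (S - U)"
  define W where "W = fps_const (1/4) * (V - U)"
  have c: "2 * fps_const (1/2) = (1 :: complex fps)" "4 * fps_const (1/4) = (1 :: complex fps)"
    unfolding fps_numeral_fps_const by simp_all
  have ST: "S = U + 2 * T" unfolding T_def mult.assoc[symmetric] c by simp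
  have VW: "V = U + 4 * W" unfolding W_def mult.assoc[symmetric] c by simp
  have "4 * (U * T + T * T) = 4 * (U * W)"
    using S(1) unfolding ST VW by (simp add: algebra_simps)
  moreover have "(4 :: complex fps) \<noteq> 0" by (simp add: fps_numeral_fps_const)
  ultimately have eq: "U * T + T * T = U * W" by (metis mult_left_cancel)
  have W: "fps_nth W k \<in> \<int>" for k using V[of k] by (simp add: W_def)
  have T0: "fps_nth T 0 = 0" by (simp add: T_def S U)
  have "fps_nth T k \<in> \<int>" for k
  proof (induction k rule: less_induct)
    case (less k)
    show ?case
    proof (cases "k = 0")
      case False
      have "fps_nth (U * T) k = fps_nth T k + (\<Sum>i=1..k. fps_nth U i * fps_nth T (k - i))"
        by (simp add: fps_mult_nth sum.atLeast_Suc_atMost U)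
      then have "fps_nth T k = fps_nth (U * W) k - fps_nth (T * T) k - (\<Sum>i=1..k. fps_nth U i * fps_nth T (k - i))"
        using arg_cong[OF eq, of "\<lambda>f. fps_nth f k"] by (simp add: algebra_simps)
      moreover have "fps_nth (U * W) k \<in> \<int>"
        unfolding fps_mult_nth by (intro Ints_sum Ints_mult U W)
      moreover have "fps_nth (T * T) k \<in> \<int>"
        unfolding fps_mult_nth
      proof (intro Ints_sum)
        fix i assume "i \<in> {0..k}"
        then show "fps_nth T i * fps_nth T (k - i) \<in> \<int>"
          using less[of i] less[of "k - i"] T0 by (cases "i = 0 \<or> i = k") (auto intro: Ints_mult)
      qed
      moreover have "(\<Sum>i=1..k. fps_nth U i * fps_nth T (k - i)) \<in> \<int>"
        using False by (intro Ints_sum Ints_mult U less) auto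
      ultimately show ?thesis by (auto intro: Ints_diff)
    qed (simp add: T0)
  qed
  then show ?thesis unfolding ST using U(2) by (auto intro!: Ints_add Ints_mult)
qed

lemma order_prod_one_minus_mult:
  fixes \<beta> :: "'j \<Rightarrow> complex"
  assumes "finite J" and "\<gamma> \<noteq> 0"
  shows "order (inverse \<gamma>) (\<Prod>j\<in>J. [:1, - \<beta> j:]) = card {j \<in> J. \<beta> j = \<gamma>}"
  using assms(1)
proof (induction J)
  case (insert j J)
  have one: "order (inverse \<gamma>) [:1, - b:] = (if b = \<gamma> then 1 else 0)" for b
  proof (cases "b = \<gamma>")
    case True
    then have "[:1, - b:] = Polynomial.smult (- \<gamma>) ([:- inverse \<gamma>, 1:] ^ 1)" using assms(2) by simp
    then show ?thesis using True assms(2) by (simp only: order_smult order_power_n_n neg_equal_0_iff_equal if_True simp_thms)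
  next
    case False
    then show ?thesis using assms(2) by (auto intro!: order_0I simp: field_simps)
  qed
  have ins: "(\<Prod>j\<in>insert j J. [:1, - \<beta> j:]) = [:1, - \<beta> j:] * (\<Prod>j\<in>J. [:1, - \<beta> j:])"
    by (rule prod.insert[OF insert.hyps])
  have nz: "[:1, - \<beta> j:] * (\<Prod>j\<in>J. [:1, - \<beta> j:]) \<noteq> 0"
    unfolding ins[symmetric] using insert.hyps by (subst prod_zero_iff) auto
  have "order (inverse \<gamma>) (\<Prod>j\<in>insert j J. [:1, - \<beta> j:])
      = (if \<beta> j = \<gamma> then 1 else 0) + card {j \<in> J. \<beta> j = \<gamma>}"
    unfolding ins order_mult[OF nz] one insert.IH ..
  also have "\<dots> = card {i \<in> insert j J. \<beta> i = \<gamma>}"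
  proof -
    have "{i \<in> insert j J. \<beta> i = \<gamma>} = (if \<beta> j = \<gamma> then insert j {i \<in> J. \<beta> i = \<gamma>} else {i \<in> J. \<beta> i = \<gamma>})"
      by auto
    then show ?thesis using insert.hyps by simp
  qed
  finally show ?case .
qed simp

text \<open>The square root \<open>S\<close> of the product has integer coefficients, so the
  vanishing Hankel determinants make it a fraction \<open>r / q\<close>. Then
  \<open>q * q * P = r * r\<close> forces even multiplicities, and that of
  \<open>inverse \<gamma>\<close> counts the pairs of \<open>x \<in> X\<close> and
  \<open>e \<in> {2, 4}\<close> with \<open>x ^ e = \<gamma>\<close>.\<close>

lemma even_multiplicities_if_hedgehog_small:
  fixes X :: "complex set"
  assumes X: "finite X" "X \<noteq> {}" "0 \<notin> X"
    and int: "\<And>k. fps_nth (\<Prod>x\<in>X. 1 - fps_const x * fps_X) k \<in> \<int>"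
    and small: "\<And>x. x \<in> X \<Longrightarrow> norm x < exp (33/2000 / real (card X))"
  shows "even (card {x \<in> X. x\<^sup>2 = \<gamma>} + card {x \<in> X. x ^ 4 = \<gamma>})"
proof (cases "\<gamma> = 0")
  case True
  then show ?thesis using X by (auto simp: card_eq_0_iff)
next
  case False
  define d where "d = real (card X)"
  have d: "1 \<le> d" using X by (simp add: d_def card_gt_0_iff Suc_le_eq)
  define T where "T = 4 * (33/2000 / d)"
  define J where "J = X \<times> {2, 4 :: nat}"
  define \<beta> where "\<beta> = (\<lambda>(x, e). x ^ e :: complex)"
  have J: "finite J" "real (card J) = 2 * d" using X by (auto simp: J_def d_def card_cartesian_product)
  have \<beta>0: "\<beta> j \<noteq> 0" if "j \<in> J" for j
    using that X by (auto simp: J_def \<beta>_def)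
  have \<beta>T: "norm (\<beta> j) < exp T" if jJ: "j \<in> J" for j
  proof -
    obtain x e where j: "j = (x, e)" "x \<in> X" "e = 2 \<or> e = 4" using jJ by (cases j) (auto simp: J_def)
    have "norm (\<beta> j) < exp (33/2000 / d) ^ e"
      using small[OF j(2)] j by (auto simp: \<beta>_def norm_power d_def intro!: power_strict_mono)
    also have "\<dots> = exp (real e * (33/2000 / d))" by (rule exp_of_nat_mult[symmetric])
    also have "\<dots> \<le> exp T" unfolding T_def exp_le_cancel_iff using j(3) d by (intro mult_right_mono) auto
    finally show ?thesis .
  qed
  \<comment> \<open>Since \<open>T\<close> is \<open>66/1000 / d\<close> and
    \<open>card J = 2 * d\<close>, the second condition is
    \<open>66 * (2 * d + 1) \<le> 198 * d\<close>, which is exactly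
    \<open>1 \<le> d\<close>.\<close>
  have T: "0 \<le> T" "T \<le> 198/1000 / (real (card J) + 1)"
    using d by (auto simp: T_def J field_simps)
  define F where "F = (\<lambda>x. \<Prod>j\<in>J. csqrt (1 - \<beta> j * x))"
  define S where "S = fps_expansion F 0"
  define U where "U = (\<Prod>x\<in>X. 1 - fps_const (x\<^sup>2) * fps_X)"
  define V where "V = (\<Prod>x\<in>X. 1 - fps_const ((x\<^sup>2)\<^sup>2) * fps_X)"
  have SJ: "S * S = (\<Prod>j\<in>J. 1 - fps_const (\<beta> j) * fps_X)"
  proof -
    have "F holomorphic_on ball 0 (exp (- T))"
      unfolding F_def
    proof (intro holomorphic_intros)
      fix x :: complex and j assume xj: "x \<in> ball 0 (exp (- T))" "j \<in> J"
      then have "norm (\<beta> j * x) < exp T * exp (- T)"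
        unfolding norm_mult using \<beta>T by (intro mult_strict_mono) auto
      then have "norm (\<beta> j * x) < 1" by (simp flip: exp_add)
      then have "Re (\<beta> j * x) < 1" using complex_Re_le_cmod[of "\<beta> j * x"] by linarith
      then show "1 - \<beta> j * x \<notin> \<real>\<^sub>\<le>\<^sub>0" by (auto simp: complex_nonpos_Reals_iff)
    qed
    then have "F has_fps_expansion S"
      unfolding S_def by (intro has_fps_expansion_fps_expansion[of "ball 0 (exp (- T))"]) auto
    then have "(\<lambda>x. F x * F x) has_fps_expansion (S * S)" by (intro has_fps_expansion_mult)
    moreover have "(\<lambda>x. F x * F x) = (\<lambda>x. \<Prod>j\<in>J. 1 - \<beta> j * x)"
      by (simp add: F_def prod_power_distrib flip: power2_eq_square)
    moreover have "(\<lambda>x. \<Prod>j\<in>J. 1 - \<beta> j * x) has_fps_expansion (\<Prod>j\<in>J. 1 - fps_const (\<beta> j) * fps_X)"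
      by (intro fps_expansion_intros)
    ultimately show ?thesis using fps_expansion_unique_complex by metis
  qed
  also have "\<dots> = U * V"
  proof -
    have "(\<Prod>j\<in>J. 1 - fps_const (\<beta> j) * fps_X) = (\<Prod>x\<in>X. \<Prod>e\<in>{2, 4}. 1 - fps_const (\<beta> (x, e)) * fps_X)"
      unfolding J_def prod.cartesian_product by (simp only: split_def prod.collapse)
    also have "\<dots> = U * V"
      unfolding U_def V_def prod.distrib[symmetric]
      by (intro prod.cong refl) (simp add: \<beta>_def flip: power_mult)
    finally show ?thesis .
  qed
  finally have SUV: "S * S = U * V" .
  have S0: "fps_nth S 0 = 1" by (simp add: S_def fps_expansion_def F_def)
  have S_int: "fps_nth S k \<in> \<int>" for k
  proof -
    have "\<forall>k. \<exists>m. fps_nth (\<Prod>x\<in>X. 1 - fps_const x * fps_X) k = of_int m"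
      using int by (auto elim!: Ints_cases)
    then obtain p where p: "\<And>k. fps_nth (\<Prod>x\<in>X. 1 - fps_const x * fps_X) k = of_int (p k)" by metis
    have U: "fps_nth U k = of_int (graeffe p k)" for k
      unfolding U_def by (rule prod_fps_squares_nth) (rule p)
    have V: "fps_nth V k = of_int (graeffe (graeffe p) k)" for k
      unfolding V_def by (rule prod_fps_squares_nth) (rule U[unfolded U_def])
    show ?thesis
    proof (rule fps_sqrt_nth_Ints[OF SUV S0])
      show "fps_nth U 0 = 1" unfolding U_def using X(1) by induction simp_all
      show "fps_nth U k \<in> \<int>" for k by (simp add: U)
      show "(fps_nth V k - fps_nth U k) / 4 \<in> \<int>" for k
      proof -
        obtain m where "graeffe (graeffe p) k - graeffe p k = 4 * m"
          using graeffe_cong_mod_4[of "graeffe p" p k] even_graeffe_diff by (auto elim: dvdE)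
        then have "(fps_nth V k - fps_nth U k) / 4 = of_int m"
          unfolding U V by (metis (no_types, opaque_lifting) of_int_diff of_int_mult of_int_numeral
              nonzero_mult_div_cancel_left zero_neq_numeral)
        then show ?thesis by simp
      qed
    qed
  qed
  obtain N0 where "\<And>N. N0 \<le> N \<Longrightarrow> det (hankel_mat (fps_nth S) N) = 0"
    using det_hankel_mat_eventually_zero[OF J(1), of \<beta> T, folded F_def, folded S_def, OF \<beta>0 \<beta>T T S_int]
    by blast
  then obtain q r where q: "q \<noteq> 0" "fps_of_poly q * S = fps_of_poly r"
    using rational_if_hankel_eventually_singular by blast
  define P where "P = (\<Prod>j\<in>J. [:1, - \<beta> j:])"
  have "fps_of_poly P = S * S"
    unfolding SJ P_def fps_of_poly_prod by (intro prod.cong refl) (simp add: fps_of_poly_linear' mult.commute)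
  then have "fps_of_poly (q * q * P) = fps_of_poly (r * r)"
    unfolding fps_of_poly_mult q(2)[symmetric] by (simp add: mult_ac)
  then have qr: "q * q * P = r * r" by simp
  have P0: "P \<noteq> 0" unfolding P_def using J by (subst prod_zero_iff) auto
  then have "r \<noteq> 0" using qr q by auto
  then have "2 * order (inverse \<gamma>) q + order (inverse \<gamma>) P = 2 * order (inverse \<gamma>) r"
    using arg_cong[OF qr, of "order (inverse \<gamma>)"] q P0 by (simp add: order_mult)
  then have "even (order (inverse \<gamma>) P)" by presburger
  also have "order (inverse \<gamma>) P = card {j \<in> J. \<beta> j = \<gamma>}"
    unfolding P_def by (rule order_prod_one_minus_mult[OF J(1) False])
  also have "{j \<in> J. \<beta> j = \<gamma>} = (\<lambda>x. (x, 2)) ` {x \<in> X. x\<^sup>2 = \<gamma>} \<union> (\<lambda>x. (x, 4)) ` {x \<in> X. x ^ 4 = \<gamma>}"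
    by (auto simp: J_def \<beta>_def)
  also have "card \<dots> = card {x \<in> X. x\<^sup>2 = \<gamma>} + card {x \<in> X. x ^ 4 = \<gamma>}"
    using X(1) by (subst card_Un_disjoint) (auto simp: card_image inj_on_def)
  finally show ?thesis .
qed

section \<open>Parity of square roots and descent to the set of squares\<close>

text \<open>Repeated squaring stays in a finite set, so two of the powers \<open>g ^ (2 ^ i)\<close>
  coincide and can be cancelled.\<close>

lemma pow2_iterates_root_of_unity:
  fixes g :: complex
  assumes Q: "finite Q" "(\<lambda>x. x\<^sup>2) ` Q \<subseteq> Q" and g: "g \<in> Q" "g \<noteq> 0"
  shows "\<exists>k>0. g ^ k = 1"
proof -
  have it: "g ^ (2 ^ k) \<in> Q" for k :: nat
  proof (induction k)
    case (Suc k)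
    then have "(g ^ (2 ^ k))\<^sup>2 \<in> Q" using Q by blast
    then show ?case by (simp flip: power_mult add: mult.commute)
  qed (use g in simp)
  have "\<not> inj (\<lambda>k :: nat. g ^ (2 ^ k))"
    using it Q(1) by (metis finite_imageD finite_subset image_subsetI infinite_UNIV_nat)
  then obtain i j :: nat where ij: "g ^ (2 ^ i) = g ^ (2 ^ j)" "i \<noteq> j" by (auto simp: inj_def)
  define a b where "a = min i j" and "b = max i j"
  have "a < b" "g ^ (2 ^ a) = g ^ (2 ^ b)"
    using ij by (auto simp: a_def b_def min_def max_def)
  moreover have "2 ^ a < (2 :: nat) ^ b" using \<open>a < b\<close> by simp
  ultimately have "g ^ (2 ^ b - 2 ^ a) = 1" "0 < (2 :: nat) ^ b - 2 ^ a"
    using g by (simp_all add: power_diff)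
  then show ?thesis by blast
qed

text \<open>Let \<open>Q\<close> be the set of values with an odd number of square roots in
  \<open>X\<close>. A value in \<open>Q\<close> also has an odd number of fourth roots in
  \<open>X\<close>; grouping these by their squares shows that one of its own square roots lies in
  \<open>Q\<close>. By finiteness squaring permutes \<open>Q\<close>, so its elements would be roots
  of unity.\<close>

lemma even_card_square_roots:
  fixes X :: "complex set"
  assumes X: "finite X" "0 \<notin> X" and nr: "\<And>x k. x \<in> X \<Longrightarrow> 0 < k \<Longrightarrow> x ^ k \<noteq> 1"
    and even: "\<And>\<gamma>. even (card {x \<in> X. x\<^sup>2 = \<gamma>} + card {x \<in> X. x ^ 4 = \<gamma>})"
  shows "even (card {x \<in> X. x\<^sup>2 = \<gamma>})"
proof (rule ccontr)
  let ?sq = "\<lambda>x :: complex. x\<^sup>2"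
  let ?m = "\<lambda>\<gamma>. card {x \<in> X. x\<^sup>2 = \<gamma>}"
  assume odd: "odd (?m \<gamma>)"
  define Q where "Q = {\<gamma>. odd (?m \<gamma>)}"
  have OX: "Q \<subseteq> ?sq ` X"
    by (auto simp: Q_def card_gt_0_iff dest!: odd_pos)
  then have fin: "finite Q" using X(1) finite_surj by blast
  have p4: "(x\<^sup>2)\<^sup>2 = x ^ 4" for x :: complex by (simp flip: power_mult)
  have "Q \<subseteq> ?sq ` Q"
  proof
    fix \<gamma> assume "\<gamma> \<in> Q"
    then have odd4: "odd (card {x \<in> X. x ^ 4 = \<gamma>})" using even[of \<gamma>] by (simp add: Q_def)
    let ?S = "{x \<in> X. x ^ 4 = \<gamma>}" and ?T = "{\<delta> \<in> ?sq ` X. \<delta>\<^sup>2 = \<gamma>}"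
    have "(\<Sum>\<delta>\<in>?T. ?m \<delta>) = (\<Sum>\<delta>\<in>?T. \<Sum>x | x \<in> ?S \<and> x\<^sup>2 = \<delta>. 1)"
    proof (intro sum.cong refl)
      fix \<delta> assume "\<delta> \<in> ?T"
      then have "x ^ 4 = \<gamma>" if "x\<^sup>2 = \<delta>" for x using p4[of x] that by simp
      then have eq: "{x. x \<in> ?S \<and> x\<^sup>2 = \<delta>} = {x \<in> X. x\<^sup>2 = \<delta>}" by blast
      show "?m \<delta> = (\<Sum>x | x \<in> ?S \<and> x\<^sup>2 = \<delta>. 1)" unfolding eq by (rule card_eq_sum)
    qed
    also have "\<dots> = (\<Sum>x\<in>?S. 1)"
      using X(1) by (intro sum.group) (auto simp: p4)
    finally have "(\<Sum>\<delta>\<in>?T. ?m \<delta>) = card ?S" unfolding card_eq_sum .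
    then have "odd (\<Sum>\<delta>\<in>?T. ?m \<delta>)" using odd4 by simp
    then have "\<not> (\<forall>\<delta>\<in>?T. even (?m \<delta>))" using dvd_sum by fast
    then obtain \<delta> where "\<delta> \<in> ?T" "odd (?m \<delta>)" by blast
    then show "\<gamma> \<in> ?sq ` Q" by (auto simp: Q_def)
  qed
  then have QQ: "Q = ?sq ` Q"
    using fin by (intro card_seteq card_image_le) auto
  have \<gamma>: "\<gamma> \<in> Q" using odd by (simp add: Q_def)
  then obtain x where x: "x \<in> X" "\<gamma> = x\<^sup>2" using OX by blast
  then have "\<gamma> \<noteq> 0" using X(2) by auto
  then obtain k where "0 < k" "\<gamma> ^ k = 1"
    using pow2_iterates_root_of_unity[OF fin _ \<gamma>] QQ by blast
  then have "x ^ (2 * k) = 1" "0 < 2 * k" by (simp_all add: x power_mult)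
  then show False using nr[OF x(1)] by blast
qed

text \<open>A fibre of squaring over \<open>Y\<close> is a nonempty subset of
  \<open>{a, - a}\<close> of even size, hence both points, and its two factors multiply to
  \<open>1 - a^2 X^2\<close>.\<close>

lemma squares_of_symmetric_set:
  fixes X :: "complex set"
  assumes X: "finite X" "0 \<notin> X" and even: "\<And>\<gamma>. even (card {x \<in> X. x\<^sup>2 = \<gamma>})"
  defines "Y \<equiv> (\<lambda>x. x\<^sup>2) ` X"
  shows "card X = 2 * card Y"
    and "(\<Prod>x\<in>X. 1 - fps_const x * fps_X) = (\<Prod>y\<in>Y. 1 - fps_const y * fps_X) oo fps_X ^ 2"
proof -
  have fib: "\<exists>a. a \<noteq> 0 \<and> y = a\<^sup>2 \<and> {x \<in> X. x\<^sup>2 = y} = {a, - a}" if y: "y \<in> Y" for y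
  proof -
    obtain a where a: "a \<in> X" "y = a\<^sup>2" using y unfolding Y_def by blast
    have sub: "{x \<in> X. x\<^sup>2 = y} \<subseteq> {a, - a}" by (auto simp: a power2_eq_iff)
    have "- a \<in> X"
    proof (rule ccontr)
      assume "- a \<notin> X"
      then have "{x \<in> X. x\<^sup>2 = y} = {a}" using sub a by auto
      then show False using even[of y] by simp
    qed
    then show ?thesis using a sub X by (intro exI[of _ a]) auto
  qed
  have Y: "finite Y" using X by (simp add: Y_def)
  have "card X = (\<Sum>y\<in>Y. \<Sum>x | x \<in> X \<and> x\<^sup>2 = y. 1)"
    using sum.group[OF X(1) Y, of "\<lambda>x. x\<^sup>2" "\<lambda>_. 1 :: nat"] by (simp add: Y_def)
  also have "\<dots> = (\<Sum>y\<in>Y. 2)"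
  proof (intro sum.cong refl)
    fix y assume "y \<in> Y"
    then obtain a where "a \<noteq> 0" "{x \<in> X. x\<^sup>2 = y} = {a, - a}" using fib by blast
    then show "(\<Sum>x | x \<in> X \<and> x\<^sup>2 = y. 1) = (2 :: nat)" by simp
  qed
  finally show "card X = 2 * card Y" by simp
  have "(\<Prod>x\<in>X. 1 - fps_const x * fps_X)
      = (\<Prod>y\<in>Y. \<Prod>x | x \<in> X \<and> x\<^sup>2 = y. 1 - fps_const x * fps_X)"
    by (rule prod.group[OF X(1) Y, symmetric]) (simp add: Y_def)
  also have "\<dots> = (\<Prod>y\<in>Y. (1 - fps_const y * fps_X) oo fps_X ^ 2)"
  proof (intro prod.cong refl)
    fix y assume "y \<in> Y"
    then obtain a where a: "a \<noteq> 0" "y = a\<^sup>2" "{x \<in> X. x\<^sup>2 = y} = {a, - a}" using fib by blast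
    have "(\<Prod>x | x \<in> X \<and> x\<^sup>2 = y. 1 - fps_const x * fps_X)
        = (1 - fps_const a * fps_X) * (1 + fps_const a * fps_X)"
      using a by (simp flip: fps_const_neg)
    also have "\<dots> = (1 - fps_const y * fps_X) oo fps_X ^ 2"
      by (simp add: a(2) fps_compose_sub_distrib fps_compose_mult_distrib power2_eq_square algebra_simps
          flip: fps_const_mult)
    finally show "(\<Prod>x | x \<in> X \<and> x\<^sup>2 = y. 1 - fps_const x * fps_X) = (1 - fps_const y * fps_X) oo fps_X ^ 2" .
  qed
  also have "\<dots> = (\<Prod>y\<in>Y. 1 - fps_const y * fps_X) oo fps_X ^ 2"
    by (subst fps_compose_prod_distrib) auto
  finally show "(\<Prod>x\<in>X. 1 - fps_const x * fps_X) = (\<Prod>y\<in>Y. 1 - fps_const y * fps_X) oo fps_X ^ 2" .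
qed

text \<open>If the bound failed, \<open>X\<close> would be symmetric under negation. The set of
  squares satisfies the same hypotheses with half as many elements, and its bound is equivalent to
  the one for \<open>X\<close>. Working with finite sets rather than with conjugates of one number
  makes this descent independent of irreducibility.\<close>

lemma exists_norm_ge_of_integral_set:
  fixes X :: "complex set"
  assumes "finite X" "X \<noteq> {}" "0 \<notin> X" and "\<And>x k. x \<in> X \<Longrightarrow> 0 < k \<Longrightarrow> x ^ k \<noteq> 1"
    and "\<And>k. fps_nth (\<Prod>x\<in>X. 1 - fps_const x * fps_X) k \<in> \<int>"
  shows "\<exists>x\<in>X. exp (33/2000 / real (card X)) \<le> norm x"
  using assms
proof (induction "card X" arbitrary: X rule: less_induct)
  case less
  note X = less.prems
  show ?case
  proof (rule ccontr)
    assume "\<not> ?thesis"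
    then have small: "norm x < exp (33/2000 / real (card X))" if "x \<in> X" for x using that by force
    have ev: "even (card {x \<in> X. x\<^sup>2 = \<gamma>})" for \<gamma>
      using even_card_square_roots[OF X(1,3,4)] even_multiplicities_if_hedgehog_small[OF X(1-3,5) small]
      by blast
    let ?Y = "(\<lambda>x. x\<^sup>2) ` X"
    note sq = squares_of_symmetric_set[OF X(1,3) ev]
    have "0 < card X" using X by (simp add: card_gt_0_iff)
    have "\<exists>y\<in>?Y. exp (33/2000 / real (card ?Y)) \<le> norm y"
    proof (rule less.hyps)
      show "card ?Y < card X" using sq(1) \<open>0 < card X\<close> by linarith
      show "finite ?Y" "?Y \<noteq> {}" "0 \<notin> ?Y" using X by auto
      show "y ^ k \<noteq> 1" if "y \<in> ?Y" "0 < k" for y k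
        using that X(4)[of _ "2 * k"] by (auto simp: power_mult)
      show "fps_nth (\<Prod>y\<in>?Y. 1 - fps_const y * fps_X) k \<in> \<int>" for k
        using X(5)[of "2 * k"] unfolding sq(2) by (simp add: fps_nth_compose_X_power)
    qed
    then obtain x where x: "x \<in> X" "exp (33/2000 / real (card ?Y)) \<le> (norm x)\<^sup>2"
      by (auto simp: norm_power)
    have "(norm x)\<^sup>2 < (exp (33/2000 / real (card X)))\<^sup>2"
      using small[OF x(1)] by (intro power_strict_mono) auto
    also have "\<dots> = exp (real 2 * (33/2000 / real (card X)))" by (rule exp_of_nat_mult[symmetric])
    also have "\<dots> = exp (33/2000 / real (card ?Y))" using sq(1) by simp
    finally show False using x(2) by simp
  qed
qed

section \<open>Minimal polynomials and numerical bounds\<close>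

lemma is_min_poly_rat_min_poly_rat:
  "algebraic \<alpha> \<Longrightarrow> is_min_poly_rat \<alpha> (min_poly_rat \<alpha>)"
  unfolding min_poly_rat_def by (rule theI') (rule min_poly_rat_ex1)

text \<open>A vanishing polynomial of least degree divides all vanishing ones by division with
  remainder. It divides the irreducible \<open>m\<close> without being a unit, so \<open>m\<close>
  divides it in turn.\<close>

lemma is_min_poly_rat_dvd:
  assumes m: "is_min_poly_rat \<alpha> m" and q: "poly (map_poly of_rat q) \<alpha> = 0"
  shows "m dvd q"
proof -
  define R where "R p \<longleftrightarrow> p \<noteq> 0 \<and> poly (map_poly of_rat p) \<alpha> = 0" for p :: "rat poly"
  have "R m" using m by (auto simp: R_def is_min_poly_rat_def)
  then obtain p where p: "R p" and min: "\<And>r. R r \<Longrightarrow> degree p \<le> degree r"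
    using ex_has_least_nat[of R m degree] by blast
  have p_dvd: "p dvd f" if f: "poly (map_poly of_rat f) \<alpha> = 0" for f
  proof (rule ccontr)
    assume "\<not> p dvd f"
    then have "f mod p \<noteq> 0" by (simp add: mod_eq_0_iff_dvd)
    moreover have "poly (map_poly of_rat (f div p * p + f mod p)) \<alpha> = 0" using f by simp
    then have "poly (map_poly of_rat (f mod p)) \<alpha> = 0"
      unfolding poly_of_rat_add poly_of_rat_mult using p by (simp add: R_def)
    ultimately have "degree p \<le> degree (f mod p)" by (intro min) (simp add: R_def)
    then show False using degree_mod_less[of p f] p \<open>f mod p \<noteq> 0\<close> by (simp add: R_def)
  qed
  have "p dvd m" "irreducible m" using m by (auto simp: is_min_poly_rat_def intro: p_dvd)
  moreover have "\<not> p dvd 1"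
  proof
    assume "p dvd 1"
    then obtain c where "p = [:c:]" by (auto simp: is_unit_poly_iff)
    then show False using p by (auto simp: R_def map_poly_pCons)
  qed
  ultimately have "m dvd p" using irreducibleD' by blast
  then show ?thesis using p_dvd[OF q] by (rule dvd_trans)
qed

lemma is_min_poly_rat_root:
  assumes "is_min_poly_rat \<alpha> m" and "poly (map_poly of_rat m) \<beta> = 0"
  shows "is_min_poly_rat \<beta> m"
  using assms by (simp add: is_min_poly_rat_def)

lemma degree_is_min_poly_rat_pos:
  assumes "is_min_poly_rat \<alpha> m"
  shows "0 < degree m"
proof (rule ccontr)
  assume "\<not> 0 < degree m"
  then obtain c where "m = [:c:]" by (auto elim: degree_eq_zeroE)
  then show False using assms by (auto simp: is_min_poly_rat_def map_poly_pCons)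
qed

text \<open>A multiple root would make \<open>m\<close> divide its own derivative, which is nonzero
  of smaller degree.\<close>

lemma rsquarefree_is_min_poly_rat:
  assumes m: "is_min_poly_rat \<alpha> m"
  shows "rsquarefree (map_poly of_rat m :: complex poly)"
  unfolding rsquarefree_roots
proof (intro allI notI, elim conjE)
  fix \<beta> :: complex assume \<beta>: "poly (map_poly of_rat m) \<beta> = 0" "poly (pderiv (map_poly of_rat m)) \<beta> = 0"
  have "pderiv (map_poly of_rat m) = (map_poly of_rat (pderiv m) :: complex poly)"
    by (rule poly_eqI) (simp add: coeff_pderiv coeff_map_poly of_rat_mult of_rat_add)
  then have "poly (map_poly of_rat (pderiv m)) \<beta> = 0" using \<beta>(2) by simp
  then have "m dvd pderiv m" by (rule is_min_poly_rat_dvd[OF is_min_poly_rat_root[OF m \<beta>(1)]])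
  then show False using degree_is_min_poly_rat_pos[OF m] by simp
qed

lemma clear_denominators:
  fixes p :: "rat poly"
  obtains a P where "0 < a" "map_poly of_int P = Polynomial.smult (of_int a) p"
proof -
  have "\<exists>a P. 0 < a \<and> map_poly of_int P = Polynomial.smult (of_int a) p"
  proof (induction p)
    case 0
    show ?case by (rule exI[of _ 1], rule exI[of _ 0]) simp
  next
    case (pCons c p)
    then obtain a P where aP: "0 < a" "map_poly of_int P = Polynomial.smult (of_int a) p" by blast
    obtain x y where xy: "c = of_int x / of_int y" "0 < y"
      by (metis Fract_of_int_quotient Rat_cases)
    have "map_poly of_int (pCons (a * x) (Polynomial.smult y P)) = Polynomial.smult (of_int (a * y)) (pCons c p)"
    proof (rule poly_eqI)
      fix i
      have "of_int (coeff P j) = of_int a * coeff p j" for j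
        using arg_cong[OF aP(2), of "\<lambda>q. coeff q j"] by (simp add: coeff_map_poly)
      then show "coeff (map_poly of_int (pCons (a * x) (Polynomial.smult y P))) i =
          coeff (Polynomial.smult (of_int (a * y)) (pCons c p)) i"
        using xy by (simp add: coeff_map_poly coeff_pCons split: nat.split)
    qed
    moreover have "0 < a * y" using aP xy by simp
    ultimately show ?case by blast
  qed
  then show thesis using that by blast
qed

lemma content_int_nonneg: "0 \<le> content (p :: int poly)"
  using normalize_content[of p] abs_ge_zero[of "content p"] by (simp only: normalize_int_def)

text \<open>Gauss's lemma: with denominators cleared, the contents of \<open>P\<close> and
  \<open>K\<close> divide the leading coefficients \<open>a\<close> and \<open>b\<close>, while
  their product is \<open>a * b\<close>. So \<open>a\<close> is the content of \<open>P\<close> and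
  divides all its coefficients.\<close>

lemma monic_factor_of_monic_int_poly:
  fixes m k :: "rat poly" and q :: "int poly"
  assumes q: "map_poly of_int q = m * k" "lead_coeff q = 1" and m: "lead_coeff m = 1"
  shows "coeff m i \<in> \<int>"
proof -
  have lk: "lead_coeff k = 1"
  proof -
    have "lead_coeff (map_poly of_int q :: rat poly) = 1" using q(2) by (simp add: degree_map_poly coeff_map_poly)
    then show ?thesis unfolding q(1) lead_coeff_mult m by simp
  qed
  obtain a P where P: "0 < a" "map_poly of_int P = Polynomial.smult (of_int a) m" by (rule clear_denominators)
  obtain b K where K: "0 < b" "map_poly of_int K = Polynomial.smult (of_int b) k" by (rule clear_denominators)
  have cP: "of_int (coeff P j) = of_int a * coeff m j" for j
    using arg_cong[OF P(2), of "\<lambda>q. coeff q j"] by (simp add: coeff_map_poly)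
  have cK: "of_int (coeff K j) = of_int b * coeff k j" for j
    using arg_cong[OF K(2), of "\<lambda>q. coeff q j"] by (simp add: coeff_map_poly)
  have "P * K = Polynomial.smult (a * b) q"
  proof (rule poly_eqI)
    fix j
    have "(of_int (coeff (P * K) j) :: rat) = of_int a * of_int b * coeff (m * k) j"
      by (simp add: coeff_mult cP cK sum_distrib_left mult_ac)
    also have "\<dots> = of_int (coeff (Polynomial.smult (a * b) q) j)"
      unfolding q(1)[symmetric] by (simp add: coeff_map_poly)
    finally show "coeff (P * K) j = coeff (Polynomial.smult (a * b) q) j" by (simp only: of_int_eq_iff)
  qed
  then have "content P * content K = content (Polynomial.smult (a * b) q)"
    by (simp flip: content_mult)
  also have "\<dots> = a * b * content q" using P(1) K(1) by (simp add: abs_mult)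
  also have "content q = 1"
  proof -
    have "content q dvd 1" using content_dvd_coeff[of q "degree q"] by (simp only: q(2))
    moreover have "0 \<le> content q" by (rule content_int_nonneg)
    ultimately show ?thesis by (simp add: zdvd1_eq)
  qed
  finally have prod: "content P * content K = a * b" by simp
  have "(of_int (coeff P (degree m)) :: rat) = of_int a" "(of_int (coeff K (degree k)) :: rat) = of_int b"
    unfolding cP cK m lk by simp_all
  then have "coeff P (degree m) = a" "coeff K (degree k) = b" by (simp_all only: of_int_eq_iff)
  then have "content P dvd a" "content K dvd b" by (metis content_dvd_coeff)+
  then have le: "content P \<le> a" "content K \<le> b" using P(1) K(1) by (simp_all add: zdvd_imp_le)
  have pos: "0 \<le> content P" "0 \<le> content K" by (rule content_int_nonneg)+
  have "content P = a"
  proof (rule ccontr)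
    assume "content P \<noteq> a"
    then have "content P * content K < a * b"
      using le pos K(1) mult_strict_right_mono[of "content P" a b] mult_left_mono[of "content K" b "content P"] by linarith
    then show False using prod by simp
  qed
  then obtain e where "coeff P i = a * e" using content_dvd_coeff[of P i] by (auto elim: dvdE)
  then have "coeff m i = of_int e" using cP[of i] P(1) by simp
  then show ?thesis by simp
qed

section \<open>Numerical location of \<open>theta 259\<close>\<close>

lemma theta_259: "0 < theta 259" "theta 259 < 1" "- 1 + theta 259 + theta 259 ^ 259 = 0"
  using theI'[OF theta_ex1[of 259]] by (simp_all add: theta_def)

lemma power_double_le:
  fixes x :: real
  assumes "x ^ n \<le> u" "0 \<le> x" "u * u \<le> v"
  shows "x ^ (2 * n) \<le> v"
  using mult_mono[OF assms(1,1)] assms by (simp add: mult_2 power_add order_trans[OF zero_le_power])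

lemma power_double_ge:
  fixes x :: real
  assumes "u \<le> x ^ n" "0 \<le> u" "v \<le> u * u"
  shows "v \<le> x ^ (2 * n)"
  using mult_mono[OF assms(1,1)] assms by (simp add: mult_2 power_add)

text \<open>The right-hand side is 1 minus the base, so this places \<open>1 / 1.016127\<close>
  below the root. The power is assembled from \<open>259 = 256 + 2 + 1\<close> by repeated squaring,
  each value being rounded up to eleven decimals.\<close>

lemma power_259_less:
  "(1000000 / 1016127 :: real) ^ 259 < 16127 / 1016127"
proof -
  let ?x = "(1000000 / 1016127 :: real)"
  have p2: "?x ^ 2 \<le> 96850979493 / 10 ^ 11" by (simp add: power2_eq_square)
  have p4: "?x ^ 4 \<le> 93801122288 / 10 ^ 11" using power_double_le[OF p2, of "93801122288 / 10 ^ 11"] by simp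
  have p8: "?x ^ 8 \<le> 87986505425 / 10 ^ 11" using power_double_le[OF p4, of "87986505425 / 10 ^ 11"] by simp
  have p16: "?x ^ 16 \<le> 77416251370 / 10 ^ 11" using power_double_le[OF p8, of "77416251370 / 10 ^ 11"] by simp
  have p32: "?x ^ 32 \<le> 59932759762 / 10 ^ 11" using power_double_le[OF p16, of "59932759762 / 10 ^ 11"] by simp
  have p64: "?x ^ 64 \<le> 35919356927 / 10 ^ 11" using power_double_le[OF p32, of "35919356927 / 10 ^ 11"] by simp
  have p128: "?x ^ 128 \<le> 12902002021 / 10 ^ 11" using power_double_le[OF p64, of "12902002021 / 10 ^ 11"] by simp
  have p256: "?x ^ 256 \<le> 1664616562 / 10 ^ 11" using power_double_le[OF p128, of "1664616562 / 10 ^ 11"] by simp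
  have "?x ^ 259 = ?x ^ (256 + 2) * ?x" by (subst power_Suc2[symmetric]) simp
  also have "\<dots> = ?x ^ 256 * ?x ^ 2 * ?x" by (simp only: power_add)
  also have "\<dots> \<le> 1664616562 / 10 ^ 11 * (96850979493 / 10 ^ 11) * ?x"
    by (intro mult_mono p256 p2 zero_le_power mult_nonneg_nonneg) simp_all
  also have "\<dots> < 16127 / 1016127" by simp
  finally show ?thesis .
qed

text \<open>The opposite comparison at \<open>1 / 1.016126\<close>, with every intermediate value
  rounded down.\<close>

lemma power_259_ge:
  "16126 / 1016126 \<le> (1000000 / 1016126 :: real) ^ 259"
proof -
  let ?x = "(1000000 / 1016126 :: real)"
  have p2: "96851170120 / 10 ^ 11 \<le> ?x ^ 2" by (simp add: power2_eq_square)
  have p4: "93801491536 / 10 ^ 11 \<le> ?x ^ 4" using power_double_ge[OF p2, of "93801491536 / 10 ^ 11"] by simp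
  have p8: "87987198143 / 10 ^ 11 \<le> ?x ^ 8" using power_double_ge[OF p4, of "87987198143 / 10 ^ 11"] by simp
  have p16: "77417470370 / 10 ^ 11 \<le> ?x ^ 16" using power_double_ge[OF p8, of "77417470370 / 10 ^ 11"] by simp
  have p32: "59934647184 / 10 ^ 11 \<le> ?x ^ 32" using power_double_ge[OF p16, of "59934647184 / 10 ^ 11"] by simp
  have p64: "35921619330 / 10 ^ 11 \<le> ?x ^ 64" using power_double_ge[OF p32, of "35921619330 / 10 ^ 11"] by simp
  have p128: "12903627352 / 10 ^ 11 \<le> ?x ^ 128" using power_double_ge[OF p64, of "12903627352 / 10 ^ 11"] by simp
  have p256: "1665035988 / 10 ^ 11 \<le> ?x ^ 256" using power_double_ge[OF p128, of "1665035988 / 10 ^ 11"] by simp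
  have "?x ^ 259 = ?x ^ (256 + 2) * ?x" by (subst power_Suc2[symmetric]) simp
  also have "\<dots> = ?x ^ 256 * ?x ^ 2 * ?x" by (simp only: power_add)
  finally have eq: "?x ^ 259 = ?x ^ 256 * ?x ^ 2 * ?x" .
  have "16126 / 1016126 \<le> 1665035988 / 10 ^ 11 * (96851170120 / 10 ^ 11) * ?x" by simp
  also have "\<dots> \<le> ?x ^ 256 * ?x ^ 2 * ?x"
    by (intro mult_mono p256 p2 zero_le_power mult_nonneg_nonneg) simp_all
  finally show ?thesis unfolding eq .
qed

lemma theta_259_bounds: "1000000 / 1016127 < theta 259" "theta 259 \<le> 1000000 / 1016126"
proof -
  note th = theta_259
  show "1000000 / 1016127 < theta 259"
  proof (rule ccontr)
    assume "\<not> ?thesis"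
    then have "theta 259 \<le> 1000000 / 1016127" by simp
    moreover from this have "theta 259 ^ 259 \<le> (1000000 / 1016127) ^ 259"
      using th by (intro power_mono) auto
    ultimately show False using th(3) power_259_less by linarith
  qed
  show "theta 259 \<le> 1000000 / 1016126"
  proof (rule ccontr)
    assume "\<not> ?thesis"
    then have "1000000 / 1016126 < theta 259" by simp
    moreover from this have "(1000000 / 1016126) ^ 259 < theta 259 ^ 259"
      using th by (intro power_strict_mono) auto
    ultimately show False using th(3) power_259_ge by linarith
  qed
qed

section \<open>The conjugates as an integral set and the bound for the house\<close>

theorem theorem1p3:
  fixes \<alpha> :: complex and c :: real
  assumes "algebraic_int \<alpha>"
    and "\<alpha> \<noteq> 0"
    and "\<not> (\<exists>k::nat. k > 0 \<and> \<alpha> ^ k = 1)"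
    and "c = inverse (theta 259) - 1"
  shows "house \<alpha> \<ge> 1 + c / real (alg_degree \<alpha>) \<and> 0.016126 \<le> c \<and> c < 0.016127"
proof -
  have c: "0.016126 \<le> c" "c < 0.016127"
    using theta_259_bounds theta_259(1) unfolding assms(4) by (simp_all add: field_simps)
  define m where "m = min_poly_rat \<alpha>"
  have m: "is_min_poly_rat \<alpha> m"
    unfolding m_def using assms(1) by (intro is_min_poly_rat_min_poly_rat) auto
  let ?p = "map_poly of_rat m :: complex poly"
  define X where "X = galois_conjugates \<alpha>"
  have Xm: "X = {\<beta>. poly ?p \<beta> = 0}" by (simp add: X_def galois_conjugates_def m_def)
  have lead: "lead_coeff ?p = 1" using m by (simp add: is_min_poly_rat_def degree_map_poly coeff_map_poly)
  then have p0: "?p \<noteq> 0" by auto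
  have fin: "finite X" unfolding Xm by (rule poly_roots_finite[OF p0])
  \<comment> \<open>Simple roots allow the product to run over the set of conjugates, whose
    cardinality is then the degree.\<close>
  have p: "?p = (\<Prod>x\<in>X. [:- x, 1:])"
    using complex_poly_decompose_rsquarefree[OF rsquarefree_is_min_poly_rat[OF m]] lead by (simp add: Xm)
  have "degree ?p = card X" unfolding p by (subst degree_prod_eq_sum_degree) auto
  then have deg: "card X = alg_degree \<alpha>" by (simp add: alg_degree_def m_def degree_map_poly)
  have aX: "\<alpha> \<in> X" using m by (simp add: Xm is_min_poly_rat_def)
  have int: "coeff ?p i \<in> \<int>" for i
  proof -
    obtain q where q: "poly (map_poly of_int q) \<alpha> = 0" "lead_coeff q = 1"
      using assms(1) by (auto simp: algebraic_int_altdef_ipoly)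
    have "map_poly of_rat (map_poly of_int q) = (map_poly of_int q :: complex poly)"
      by (rule poly_eqI) (simp add: coeff_map_poly)
    then have "m dvd map_poly of_int q" using q(1) by (intro is_min_poly_rat_dvd[OF m]) simp
    then obtain k where "map_poly of_int q = m * k" by (elim dvdE)
    then have "coeff m i \<in> \<int>"
      using q(2) m by (intro monic_factor_of_monic_int_poly) (auto simp: is_min_poly_rat_def)
    then show ?thesis by (auto simp: coeff_map_poly elim!: Ints_cases)
  qed
  have "\<exists>x\<in>X. exp (33/2000 / real (card X)) \<le> norm x"
  proof (rule exists_norm_ge_of_integral_set[OF fin])
    show "X \<noteq> {}" using aX by auto
    show "0 \<notin> X"
    proof
      assume "0 \<in> X"
      then have "m dvd [:0, 1:]"
        by (intro is_min_poly_rat_dvd[OF is_min_poly_rat_root[OF m]]) (auto simp: Xm map_poly_pCons)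
      then obtain k where "[:0, 1:] = m * k" by (elim dvdE)
      then have "poly (map_poly of_rat [:0, 1:]) \<alpha> = 0"
        using aX by (simp only: poly_of_rat_mult) (simp add: Xm)
      then show False using assms(2) by (simp add: map_poly_pCons)
    qed
    \<comment> \<open>If one conjugate were a root of unity, \<open>m\<close> would divide
      \<open>X^k - 1\<close>, and \<open>\<alpha>\<close> would be one too.\<close>
    show "x ^ k \<noteq> 1" if "x \<in> X" "0 < k" for x k
    proof
      assume "x ^ k = 1"
      have e: "poly (map_poly of_rat (monom 1 k + [:- 1:])) z = z ^ k - 1" for z :: complex
        unfolding poly_of_rat_add by (simp add: map_poly_monom poly_monom map_poly_pCons)
      have "m dvd monom 1 k + [:- 1:]"
        using that \<open>x ^ k = 1\<close> by (intro is_min_poly_rat_dvd[OF is_min_poly_rat_root[OF m]]) (simp_all add: Xm e)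
      then obtain r where "monom 1 k + [:- 1:] = m * r" by (elim dvdE)
      then have "poly (map_poly of_rat (monom 1 k + [:- 1:])) \<alpha> = 0"
        using aX by (simp only: poly_of_rat_mult) (simp add: Xm)
      then have "\<alpha> ^ k = 1" by (simp add: e)
      then show False using assms(3) that(2) by blast
    qed
    show "fps_nth (\<Prod>x\<in>X. 1 - fps_const x * fps_X) k \<in> \<int>" for k
    proof -
      \<comment> \<open>The power series is the reversed minimal polynomial, so its coefficients are
        integers.\<close>
      have reflect: "[:1, - x:] = reflect_poly [:- x, 1:]" for x :: complex
        by (rule poly_eqI) (auto simp: coeff_reflect_poly coeff_pCons split: nat.splits)
      have "(\<Prod>x\<in>X. 1 - fps_const x * fps_X) = fps_of_poly (\<Prod>x\<in>X. reflect_poly [:- x, 1:])"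
        unfolding fps_of_poly_prod reflect[symmetric]
        by (intro prod.cong refl) (simp add: fps_of_poly_linear' mult.commute)
      also have "\<dots> = fps_of_poly (reflect_poly ?p)" unfolding p reflect_poly_prod ..
      finally show ?thesis
        by (simp add: coeff_reflect_poly int)
    qed
  qed
  then obtain x where x: "x \<in> X" "exp (33/2000 / real (alg_degree \<alpha>)) \<le> norm x" unfolding deg by blast
  \<comment> \<open>The constant \<open>33/2000 = 0.0165\<close> exceeds \<open>c\<close>, which is
    less than \<open>0.016127\<close>.\<close>
  have "1 + c / real (alg_degree \<alpha>) \<le> 1 + 33/2000 / real (alg_degree \<alpha>)"
    using c by (intro add_left_mono divide_right_mono) auto
  also have "\<dots> \<le> exp (33/2000 / real (alg_degree \<alpha>))" by (rule exp_ge_add_one_self)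
  also have "\<dots> \<le> norm x" by (fact x(2))
  also have "\<dots> \<le> house \<alpha>"
    unfolding house_def X_def[symmetric] using fin x(1) by (intro Max_ge) auto
  finally show ?thesis using c by simp
qed

end
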